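(* Let $\mathcal{T}_1,\mathcal{T}_2,\dots$ be i.i.d. Geometric$(1/2)$-Galton–Watson trees, and let $(\tilde X,N)$ be independent of $\mathcal{T}_1,\mathcal{T}_2,\dots$ with $\tilde X$ having the size-biased Geometric$(1/2)$ distribution $\mathbb{P}(\tilde X=k)=k\,2^{-k-1}$ ($k\ge1$) and, conditionally on $\tilde X=k$, $N$ uniformly distributed on $\{1,\dots,k\}$. If $\tau_n$ is a uniformly random element of $\mathrm{Av}_n(321)$, then as $n\to\infty$ \[ \left( \sum_{i=1}^{\lfloor n/2\rfloor} \delta_i \mathbf{1}_{\{\tau_n(i)=i\}} ,\ \sum_{i=\lfloor n/2\rfloor+1}^n \delta_{n+1-i} \mathbf{1}_{\{\tau_n(i)=i\}} \right)\overset{d}{\longrightarrow} \left( \sum_{i=1}^{N-1} \delta_{\sum_{j=1}^i \#\mathcal{T}_j} \mathbf{1}_{\{\#\mathcal{T}_i=1\}},\ \sum_{i=N+1}^{\tilde X} \delta_{\sum_{j=i}^{\tilde X} \#\mathcal{T}_j} \mathbf{1}_{\{\#\mathcal{T}_{i}=1\}}\right),\] the convergence being in distribution on $\mathcal{M}_F(\{1,2,3,\dots\})^2$.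
   Context: $\mathrm{Av}_n(321)$ is the set of permutations $\tau\in S_n$ containing no indices $i<j<k$ with $\tau(i)>\tau(j)>\tau(k)$. A Geometric$(1/2)$-Galton–Watson tree is a random rooted plane (ordered) tree $T$ in which the root has a number of children with law $\xi(k)=2^{-k-1}$, $k\ge0$, and each vertex independently has children according to $\xi$; equivalently, for each finite rooted plane tree $\mathbf t$, $\mathbb{P}(T=\mathbf t)=\prod_{u\in\mathbf t}\xi(d_{\mathbf t}(u))$ where $d_{\mathbf t}(u)$ is the number of children of $u$. Such a tree is almost surely finite. $\#\mathbf t$ denotes the number of vertices of $\mathbf t$. $\delta_x$ is the unit point mass at $x$. $\mathcal{M}_F(\{1,2,3,\dots\})$ is the set of finite measures on $\{1,2,3,\dots\}$ with the topology generated by the maps $\mu\mapsto\int f\,d\mu$ for bounded $f$. *)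

theory Defs
  imports "HOL-Probability.Probability"
begin

definition Av321 :: "nat \<Rightarrow> (nat \<Rightarrow> nat) set" where
  "Av321 n = {\<tau>. \<tau> permutes {1..n} \<and>
     \<not> (\<exists>i j k. 1 \<le> i \<and> i < j \<and> j < k \<and> k \<le> n \<and> \<tau> i > \<tau> j \<and> \<tau> j > \<tau> k)}"

text \<open>A finite measure on the positive integers is represented by its mass function
  m :: nat => real (m k = mass of the point k), nonnegative, summable, with m 0 = 0.\<close>

definition MF :: "(nat \<Rightarrow> real) set" where
  "MF = {m. (\<forall>k. 0 \<le> m k) \<and> m 0 = 0 \<and> summable m}"

definition integ :: "(nat \<Rightarrow> real) \<Rightarrow> (nat \<Rightarrow> real) \<Rightarrow> real" where
  "integ f m = (\<Sum>k. f k * m k)"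

definition MF_topology :: "(nat \<Rightarrow> real) topology" where
  "MF_topology = topology_generated_by
     {{m \<in> MF. integ f m \<in> U} | f U. bounded (range f) \<and> open U}"

definition dirac :: "nat \<Rightarrow> nat \<Rightarrow> real" where
  "dirac x = (\<lambda>k. if k = x then 1 else 0)"

datatype ptree = Node "ptree list"

fun tsize :: "ptree \<Rightarrow> nat" where
  "tsize (Node ts) = 1 + sum_list (map tsize ts)"

text \<open>P(T = t) = product over vertices u of xi(d(u)), xi(k) = 2^(-k-1).\<close>
fun gw_prob :: "ptree \<Rightarrow> real" where
  "gw_prob (Node ts) = (1/2) ^ (length ts + 1) * prod_list (map gw_prob ts)"

definition fixed_measures :: "nat \<Rightarrow> (nat \<Rightarrow> nat) \<Rightarrow> (nat \<Rightarrow> real) \<times> (nat \<Rightarrow> real)" where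
  "fixed_measures n \<tau> =
    ((\<lambda>k. \<Sum>i\<in>{1..n div 2}. dirac i k * (if \<tau> i = i then 1 else 0)),
     (\<lambda>k. \<Sum>i\<in>{n div 2 + 1..n}. dirac (n + 1 - i) k * (if \<tau> i = i then 1 else 0)))"

definition limit_measures :: "nat \<Rightarrow> nat \<Rightarrow> (nat \<Rightarrow> ptree) \<Rightarrow> (nat \<Rightarrow> real) \<times> (nat \<Rightarrow> real)" where
  "limit_measures X N T =
    ((\<lambda>k. \<Sum>i\<in>{1..N - 1}. dirac (\<Sum>j\<in>{1..i}. tsize (T j)) k
                              * (if tsize (T i) = 1 then 1 else 0)),
     (\<lambda>k. \<Sum>i\<in>{N + 1..X}. dirac (\<Sum>j\<in>{i..X}. tsize (T j)) k
                              * (if tsize (T i) = 1 then 1 else 0)))"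

end

theory Submission
  imports Defs
begin

text \<open>
  A fixed point \<open>s\<close> of a 321-avoiding permutation splits it into a 321-avoiding permutation of
  \<open>{1..s - 1}\<close>, the point \<open>s\<close>, and a 321-avoiding permutation of what lies to the right of \<open>s\<close>.
  Hence the number of \<open>\<tau> \<in> Av321 n\<close> with a prescribed set of fixed points is a product of Fine
  numbers $F_k$ (counting the 321-avoiding derangements) over the gaps between them. Since
  $|Av_n(321)| = C_n$ is a Catalan number and $F_n / C_n \to 4/9$, the probability of seeing a
  given pair of finite configurations at the two ends converges to $\frac49$ times a product of
  factors $F_k 4^{-k-1}$, one for each gap $k$.

  On the limit side \<open>N - 1\<close> and \<open>X - N\<close> are independent Geometric(1/2) variables, and a
  Galton-Watson tree has size \<open>s\<close> with probability $2 C_{s-1} 4^{-s}$. Cutting the sequence of trees at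
  the trees of size one and using $F = 1/(1 - x(C - 1))$ gives the same product, with
  $\frac49 = (\frac23)^2$. Configurations form a countable set, so pointwise convergence to a
  probability mass function already yields convergence of all bounded expectations.
\<close>

section \<open>Catalan numbers as tree counts\<close>

text \<open>The two sides meet in one code: a configuration is the list of its gaps, read from its
  own end. On the permutation side only the central gap grows with n, so the limit needs nothing but
  ratios F_(n-a) / C_n, and these come from linear recurrences. The limit 4/9 is the solution of r =
  1/2 - r/8, which arises from 2 F_(n+1) + F_n = C_(n+1) and C_n / C_(n+1) -> 1/4. On the tree side
  each end contributes 4/3, the solution of x = 1 + (1/2 - 1/4) x for the total weight of the trees
  behind the last singleton, and the two stopping factors 1/2 turn (4/3)^2 into 4/9. The count of
  Av_n(321) comes from inserting the maximum: the number of ways to do so depends only on the length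
  of the final increasing run. Taking C_n as a number of plane trees makes it directly the
  coefficient in the size law.\<close>

lemma tsize_pos: "0 < tsize t"
  by (cases t) simp

text \<open>A tree with s vertices has s - 1 edges, so its probability is 2^(-(s - 1) - s) = 2 / 4^s
  and depends on the size alone. The extra factor 2 makes the claim multiplicative over the subtrees
  of a root.\<close>

lemma gw_prob_eq: "2 * gw_prob t = (1/4) ^ tsize t * 4"
proof (induction t)
  case (Node ts)
  have "2 ^ length ts * prod_list (map gw_prob ts) = (1/4) ^ sum_list (map tsize ts) * 4 ^ length ts"
    using Node
  proof (induction ts)
    case (Cons t ts)
    have "2 ^ length (t # ts) * prod_list (map gw_prob (t # ts))
        = (2 * gw_prob t) * (2 ^ length ts * prod_list (map gw_prob ts))"
      by simp
    also have "\<dots> = ((1/4) ^ tsize t * 4) * ((1/4) ^ sum_list (map tsize ts) * 4 ^ length ts)"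
      using Cons by simp
    finally show ?case
      by (simp add: power_add)
  qed simp
  moreover have four: "(4 :: real) ^ k = 2 ^ k * 2 ^ k" for k
    by (simp flip: power_mult_distrib)
  ultimately have "prod_list (map gw_prob ts) = (1/4) ^ sum_list (map tsize ts) * 4 ^ length ts / 2 ^ length ts"
    by (simp add: field_simps)
  also have "\<dots> = (1/4) ^ sum_list (map tsize ts) * 2 ^ length ts"
    by (simp add: four)
  finally show ?case
    by (simp add: power_one_over)
qed

definition trees :: "nat \<Rightarrow> ptree set" where
  "trees s = {t. tsize t = s}"

text \<open>The n-th Catalan number, as the number of plane trees with n edges.\<close>

definition cat :: "nat \<Rightarrow> nat" where
  "cat n = card (trees (Suc n))"

text \<open>Every tree with more than one vertex arises exactly once by attaching a leftmost subtree
  to its root; this yields the Catalan convolution.\<close>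

fun graft :: "ptree \<times> ptree \<Rightarrow> ptree" where
  "graft (t, Node ts) = Node (t # ts)"

lemma tsize_graft [simp]: "tsize (graft (t, t')) = tsize t + tsize t'"
  by (cases t') simp

lemma inj_graft: "inj graft"
proof (rule injI)
  fix x y assume "graft x = graft y"
  thus "x = y"
    by (cases x rule: graft.cases; cases y rule: graft.cases) simp
qed

lemma trees_0: "trees 0 = {}"
  using tsize_pos by (auto simp: trees_def)

lemma trees_1: "trees (Suc 0) = {Node []}"
proof -
  have "t = Node []" if "tsize t = Suc 0" for t
  proof (cases t)
    case (Node ts)
    thus ?thesis using that tsize_pos[of "hd ts"] by (cases ts) auto
  qed
  thus ?thesis by (auto simp: trees_def)
qed

lemma trees_Suc_Suc:
  "trees (Suc (Suc n)) = graft ` (\<Union>i\<in>{0..n}. trees (Suc i) \<times> trees (Suc (n - i)))"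
proof (intro equalityI subsetI)
  fix t assume t: "t \<in> trees (Suc (Suc n))"
  obtain ts where "t = Node ts" by (cases t)
  with t obtain a as where as: "t = Node (a # as)"
    by (cases ts) (auto simp: trees_def)
  define b where "b = Node as"
  have tg: "t = graft (a, b)" using as by (simp add: b_def)
  have "tsize a + tsize b = Suc (Suc n)" using t by (simp add: tg trees_def)
  moreover obtain i where "tsize a = Suc i" using tsize_pos[of a] by (cases "tsize a") auto
  ultimately have "(a, b) \<in> trees (Suc i) \<times> trees (Suc (n - i))" "i \<le> n"
    using tsize_pos[of b] by (auto simp: trees_def)
  thus "t \<in> graft ` (\<Union>i\<in>{0..n}. trees (Suc i) \<times> trees (Suc (n - i)))"
    unfolding tg by (intro imageI UN_I[of i]) auto
qed (auto simp: trees_def)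

lemma finite_trees: "finite (trees s)"
proof (induction s rule: less_induct)
  case (less s)
  consider "s = 0" | "s = Suc 0" | n where "s = Suc (Suc n)"
    by (metis not0_implies_Suc)
  thus ?case
    by cases (use less in \<open>auto simp: trees_0 trees_1 trees_Suc_Suc\<close>)
qed

lemma cat_0 [simp]: "cat 0 = 1"
  by (simp add: cat_def trees_1)

lemma cat_Suc: "cat (Suc n) = (\<Sum>i=0..n. cat i * cat (n - i))"
proof -
  have "cat (Suc n) = card (\<Union>i\<in>{0..n}. trees (Suc i) \<times> trees (Suc (n - i)))"
    unfolding cat_def trees_Suc_Suc by (rule card_image) (rule inj_on_subset[OF inj_graft], simp)
  also have "\<dots> = (\<Sum>i=0..n. card (trees (Suc i) \<times> trees (Suc (n - i))))"
  proof (intro card_UN_disjoint ballI impI)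
    fix i j :: nat assume "i \<noteq> j"
    thus "(trees (Suc i) \<times> trees (Suc (n - i))) \<inter> (trees (Suc j) \<times> trees (Suc (n - j))) = {}"
      by (auto simp: trees_def)
  qed (simp_all add: finite_trees)
  finally show ?thesis
    by (simp add: card_cartesian_product cat_def)
qed

lemma cat_pos: "0 < cat n"
proof (induction n)
  case (Suc n)
  have "0 < cat 0 * cat (n - 0)" using Suc by simp
  also have "\<dots> \<le> (\<Sum>i=0..n. cat i * cat (n - i))"
    by (rule member_le_sum) auto
  finally show ?case by (simp add: cat_Suc)
qed simp

section \<open>Catalan generating function and the ratio of consecutive Catalan numbers\<close>

definition catF :: "real fps" where
  "catF = Abs_fps (\<lambda>n. real (cat n))"

lemma catF_eq: "catF = 1 + fps_X * catF * catF"
proof (rule fps_ext)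
  fix n show "fps_nth catF n = fps_nth (1 + fps_X * catF * catF) n"
  proof (cases n)
    case (Suc m)
    have "fps_nth (1 + fps_X * catF * catF) n = fps_nth (catF * catF) m"
      by (simp add: Suc mult.assoc)
    thus ?thesis
      by (simp add: Suc fps_mult_nth catF_def cat_Suc)
  qed (simp add: catF_def)
qed

text \<open>Differentiating $S^2 = 1 - 4x$, where $S = 1 - 2xC(x)$.\<close>
lemma cat_rec: "real (n + 2) * real (cat (Suc n)) = real (4 * n + 2) * real (cat n)"
proof -
  define S where "S = 1 - 2 * fps_X * catF"
  have sq: "S * S = 1 - 4 * fps_X"
  proof -
    have "S * S = 1 - 4 * fps_X * (catF - fps_X * catF * catF)"
      by (simp add: S_def algebra_simps)
    also have "catF - fps_X * catF * catF = 1"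
      using catF_eq by (simp add: algebra_simps)
    finally show ?thesis by simp
  qed
  have "fps_deriv (S * S) = - 4"
    by (simp add: sq)
  hence "2 * (S * fps_deriv S) = 2 * (- 2)"
    by (simp add: algebra_simps)
  hence d: "S * fps_deriv S = - 2"
    by (subst (asm) mult_left_cancel) simp_all
  \<comment> \<open>Multiplying S S' = -2 by S gives the linear equation (1 - 4x) S' = -2 S, whose
    coefficients obey a two-term recurrence.\<close>
  have "(1 - 4 * fps_X) * fps_deriv S = S * (S * fps_deriv S)"
    by (simp only: sq[symmetric] mult.assoc)
  hence e: "fps_deriv S - fps_const 4 * (fps_X * fps_deriv S) = - fps_const 2 * S"
    by (simp add: d algebra_simps numeral_fps_const)
  have nth: "fps_nth S (Suc m) = - 2 * real (cat m)" for m
  proof -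
    have "S = 1 - fps_const 2 * (fps_X * catF)"
      by (simp add: S_def numeral_fps_const mult.assoc)
    thus ?thesis by (simp add: catF_def)
  qed
  have "fps_nth (fps_deriv S - fps_const 4 * (fps_X * fps_deriv S)) (Suc n)
      = fps_nth (- fps_const 2 * S) (Suc n)"
    by (simp only: e)
  thus ?thesis
    by (simp add: nth algebra_simps)
qed

lemma cat_ratio: "(\<lambda>n. real (cat n) / real (cat (Suc n))) \<longlonglongrightarrow> 1 / 4"
proof -
  have "real (cat n) / real (cat (Suc n)) = real (n + 2) / real (4 * n + 2)" for n
    using cat_rec[of n] cat_pos[of "Suc n"]
    by (simp add: divide_simps algebra_simps)
  moreover have "(\<lambda>n. real (n + 2) / real (4 * n + 2)) \<longlonglongrightarrow> 1 / 4"
    by real_asymp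
  ultimately show ?thesis by simp
qed

lemma cat_ratio_add: "(\<lambda>n. real (cat n) / real (cat (n + a))) \<longlonglongrightarrow> (1 / 4) ^ a"
proof (induction a)
  case 0
  show ?case using cat_pos by (simp add: less_imp_neq[THEN not_sym])
next
  case (Suc a)
  have "(\<lambda>n. real (cat n) / real (cat (n + a)) * (real (cat (n + a)) / real (cat (Suc (n + a)))))
      \<longlonglongrightarrow> (1 / 4) ^ a * (1 / 4)"
    by (intro tendsto_mult Suc LIMSEQ_ignore_initial_segment[OF cat_ratio])
  thus ?case using cat_pos by (simp add: less_imp_neq[THEN not_sym] mult.commute)
qed

section \<open>Counting 321-avoiding permutations\<close>

lemma Av321D:
  assumes "\<tau> \<in> Av321 n"
  shows "\<tau> permutes {1..n}"
    and "\<lbrakk>1 \<le> i; i < j; j < k; k \<le> n; \<tau> j < \<tau> i; \<tau> k < \<tau> j\<rbrakk> \<Longrightarrow> False"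
  using assms by (auto simp: Av321_def)

lemma Av321I:
  assumes "\<tau> permutes {1..n}"
    and "\<And>i j k. \<lbrakk>1 \<le> i; i < j; j < k; k \<le> n; \<tau> j < \<tau> i; \<tau> k < \<tau> j\<rbrakk> \<Longrightarrow> False"
  shows "\<tau> \<in> Av321 n"
  using assms by (auto simp: Av321_def)

lemma finite_Av321: "finite (Av321 n)"
  by (rule finite_subset[OF _ finite_permutations[of "{1..n}"]]) (auto simp: Av321_def)

lemma id_in_Av321: "id \<in> Av321 n"
  by (auto simp: Av321_def permutes_id)

lemma permutes_finiteI:
  assumes "finite S" "inj_on f S" "f ` S \<subseteq> S" "\<And>x. x \<notin> S \<Longrightarrow> f x = x"
  shows "f permutes S"
  by (rule bij_imp_permutes) (use assms endo_inj_surj[of S f] in \<open>auto simp: bij_betw_def\<close>)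

lemma permutes_Icc_bounds:
  fixes \<tau> :: "nat \<Rightarrow> nat"
  assumes "\<tau> permutes {1..n}" "1 \<le> i" "i \<le> n"
  shows "1 \<le> \<tau> i" "\<tau> i \<le> n"
  using permutes_in_image[OF assms(1), of i] assms(2,3) by auto

section \<open>Last descents and insertion of the maximum\<close>

definition inc_after :: "nat \<Rightarrow> (nat \<Rightarrow> nat) \<Rightarrow> nat \<Rightarrow> bool" where
  "inc_after n \<sigma> d \<longleftrightarrow> (\<forall>i k. d < i \<and> i < k \<and> k \<le> n \<longrightarrow> \<sigma> i < \<sigma> k)"

text \<open>This is 0 if there is no descent.\<close>
definition last_desc :: "nat \<Rightarrow> (nat \<Rightarrow> nat) \<Rightarrow> nat" where
  "last_desc n \<sigma> = (LEAST d. inc_after n \<sigma> d)"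

text \<open>\<open>inc_after\<close> is upward closed in \<open>d\<close> and holds for
  \<open>d = n\<close>, so its least witness decides it.\<close>

lemma inc_after_iff: "inc_after n \<sigma> d \<longleftrightarrow> last_desc n \<sigma> \<le> d"
proof
  show "inc_after n \<sigma> d \<Longrightarrow> last_desc n \<sigma> \<le> d"
    unfolding last_desc_def by (rule Least_le)
  have "inc_after n \<sigma> n"
    by (auto simp: inc_after_def)
  hence "inc_after n \<sigma> (last_desc n \<sigma>)"
    unfolding last_desc_def by (rule LeastI)
  thus "last_desc n \<sigma> \<le> d \<Longrightarrow> inc_after n \<sigma> d"
    by (auto simp: inc_after_def)
qed

lemma last_desc_eqI: "(\<And>e. inc_after n \<sigma> e \<longleftrightarrow> d \<le> e) \<Longrightarrow> last_desc n \<sigma> = d"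
  by (metis inc_after_iff order_antisym order_refl)

lemma last_desc_le: "last_desc n \<sigma> \<le> n"
  by (auto simp: inc_after_iff[symmetric] inc_after_def)

text \<open>Positions from \<open>p\<close> on shift to the right by one. Beyond
  \<open>Suc n\<close> the map is the identity, as \<open>permutes\<close> demands.\<close>

definition insert_max :: "nat \<Rightarrow> nat \<Rightarrow> (nat \<Rightarrow> nat) \<Rightarrow> nat \<Rightarrow> nat" where
  "insert_max n p \<sigma> i =
     (if i < p then \<sigma> i else if i = p then Suc n else if i \<le> Suc n then \<sigma> (i - 1) else i)"

definition delete_pos :: "nat \<Rightarrow> nat \<Rightarrow> (nat \<Rightarrow> nat) \<Rightarrow> nat \<Rightarrow> nat" where
  "delete_pos n p \<tau> i = (if i < p then \<tau> i else if i \<le> n then \<tau> (Suc i) else i)"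

lemma insert_max_permutes:
  assumes \<sigma>: "\<sigma> permutes {1..n}" and p: "1 \<le> p" "p \<le> Suc n"
  shows "insert_max n p \<sigma> permutes {1..Suc n}"
proof (rule permutes_finiteI)
  have inj: "\<sigma> i = \<sigma> j \<longleftrightarrow> i = j" for i j
    using permutes_inj[OF \<sigma>] by (auto dest: injD)
  define r where "r x = (if x < p then x else x - 1)" for x
  have r: "r x \<in> {1..n}" "insert_max n p \<sigma> x = \<sigma> (r x)" if "x \<in> {1..Suc n}" "x \<noteq> p" for x
    using that p by (auto simp: insert_max_def r_def)
  have b: "\<sigma> (r x) \<in> {1..n}" if "x \<in> {1..Suc n}" "x \<noteq> p" for x
    using permutes_in_image[OF \<sigma>] r(1)[OF that] by blast
  have insp: "insert_max n p \<sigma> p = Suc n"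
    by (simp add: insert_max_def)
  show "inj_on (insert_max n p \<sigma>) {1..Suc n}"
  proof (rule inj_onI)
    fix x y
    assume xy: "x \<in> {1..Suc n}" "y \<in> {1..Suc n}" "insert_max n p \<sigma> x = insert_max n p \<sigma> y"
    show "x = y"
    proof (cases "x = p \<or> y = p")
      case True
      thus ?thesis using xy insp b[of x] b[of y] r(2)[of x] r(2)[of y] by force
    next
      case False
      hence "r x = r y" using xy r(2)[of x] r(2)[of y] inj by simp
      thus ?thesis using False by (auto simp: r_def split: if_splits)
    qed
  qed
  show "insert_max n p \<sigma> ` {1..Suc n} \<subseteq> {1..Suc n}"
  proof (rule image_subsetI)
    fix x assume x: "x \<in> {1..Suc n}"
    show "insert_max n p \<sigma> x \<in> {1..Suc n}"
      by (cases "x = p") (use x insp b[OF x] r(2)[OF x] in auto)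
  qed
  show "x \<notin> {1..Suc n} \<Longrightarrow> insert_max n p \<sigma> x = x" for x
    using p permutes_not_in[OF \<sigma>, of x] by (auto simp: insert_max_def)
qed simp

lemma delete_pos_permutes:
  assumes \<tau>: "\<tau> permutes {1..Suc n}" and p: "1 \<le> p" "p \<le> Suc n" "\<tau> p = Suc n"
  shows "delete_pos n p \<tau> permutes {1..n}"
proof (rule permutes_finiteI)
  have inj: "\<tau> i = \<tau> j \<longleftrightarrow> i = j" for i j
    using permutes_inj[OF \<tau>] by (auto dest: injD)
  have b: "1 \<le> i \<Longrightarrow> i \<le> Suc n \<Longrightarrow> i \<noteq> p \<Longrightarrow> 1 \<le> \<tau> i \<and> \<tau> i \<le> n" for i
    using permutes_Icc_bounds[OF \<tau>, of i] inj[of i p] p(3) by auto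
  show "inj_on (delete_pos n p \<tau>) {1..n}"
    by (rule inj_onI) (auto simp: delete_pos_def inj split: if_splits)
  show "delete_pos n p \<tau> ` {1..n} \<subseteq> {1..n}"
  proof (rule image_subsetI)
    fix x assume "x \<in> {1..n}"
    thus "delete_pos n p \<tau> x \<in> {1..n}"
      using p b[of x] b[of "Suc x"] by (auto simp: delete_pos_def)
  qed
  show "delete_pos n p \<tau> x = x" if "x \<notin> {1..n}" for x
    using p permutes_not_in[OF \<tau>, of x] that by (auto simp: delete_pos_def)
qed simp

text \<open>The new maximum can only be the largest entry of a 321 pattern, and then the other two
  form an inversion to its right, which \<open>last_desc n \<sigma> < p\<close> excludes.\<close>

lemma insert_max_Av321:
  assumes \<sigma>: "\<sigma> \<in> Av321 n" and p: "1 \<le> p" "p \<le> Suc n" "last_desc n \<sigma> < p"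
  shows "insert_max n p \<sigma> \<in> Av321 (Suc n)"
proof (rule Av321I)
  show per: "insert_max n p \<sigma> permutes {1..Suc n}"
    using \<sigma> p by (intro insert_max_permutes Av321D)
  have inc: "inc_after n \<sigma> (p - 1)"
    using p by (simp add: inc_after_iff)
  fix i j k
  assume ijk: "1 \<le> i" "i < j" "j < k" "k \<le> Suc n"
    "insert_max n p \<sigma> j < insert_max n p \<sigma> i" "insert_max n p \<sigma> k < insert_max n p \<sigma> j"
  define r where "r x = (if x < p then x else x - 1)" for x
  have ins: "insert_max n p \<sigma> x = \<sigma> (r x)" if "x \<noteq> p" "x \<le> Suc n" for x
    using that by (auto simp: insert_max_def r_def)
  have insp: "insert_max n p \<sigma> p = Suc n"
    by (simp add: insert_max_def)
  have le: "insert_max n p \<sigma> x \<le> Suc n" if "1 \<le> x" "x \<le> Suc n" for x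
    using permutes_Icc_bounds[OF per, of x] that by auto
  have "j \<noteq> p" "k \<noteq> p"
    using ijk le[of i] le[of j] insp by auto
  show False
  proof (cases "i = p")
    case True
    hence "\<sigma> (r j) < \<sigma> (r k)"
      using ijk by (intro inc[unfolded inc_after_def, rule_format]) (auto simp: r_def)
    thus False
      using ijk ins[of j] ins[of k] \<open>j \<noteq> p\<close> \<open>k \<noteq> p\<close> by auto
  next
    case False
    show False
    proof (rule Av321D(2)[OF \<sigma>])
      show "1 \<le> r i" "r i < r j" "r j < r k" "r k \<le> n"
        using ijk p False \<open>j \<noteq> p\<close> \<open>k \<noteq> p\<close> by (auto simp: r_def)
      show "\<sigma> (r j) < \<sigma> (r i)" "\<sigma> (r k) < \<sigma> (r j)"
        using ijk ins[of i] ins[of j] ins[of k] False \<open>j \<noteq> p\<close> \<open>k \<noteq> p\<close> by auto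
    qed
  qed
qed

text \<open>Deletion keeps the relative order of the other entries. An inversion at or beyond
  position \<open>p\<close> of the shortened word would have formed 321 with the maximum.\<close>

lemma delete_pos_Av321:
  assumes \<tau>: "\<tau> \<in> Av321 (Suc n)" and p: "1 \<le> p" "p \<le> Suc n" "\<tau> p = Suc n"
  shows "delete_pos n p \<tau> \<in> Av321 n" "last_desc n (delete_pos n p \<tau>) < p"
proof -
  note per = Av321D(1)[OF \<tau>]
  show "delete_pos n p \<tau> \<in> Av321 n"
  proof (rule Av321I)
    show "delete_pos n p \<tau> permutes {1..n}"
      by (rule delete_pos_permutes[OF per p])
    fix i j k
    assume ijk: "1 \<le> i" "i < j" "j < k" "k \<le> n"
      "delete_pos n p \<tau> j < delete_pos n p \<tau> i" "delete_pos n p \<tau> k < delete_pos n p \<tau> j"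
    define r where "r x = (if x < p then x else Suc x)" for x
    have del: "delete_pos n p \<tau> x = \<tau> (r x)" if "x \<le> n" for x
      using that by (auto simp: delete_pos_def r_def)
    show False
    proof (rule Av321D(2)[OF \<tau>])
      show "1 \<le> r i" "r i < r j" "r j < r k" "r k \<le> Suc n"
        using ijk by (auto simp: r_def)
      show "\<tau> (r j) < \<tau> (r i)" "\<tau> (r k) < \<tau> (r j)"
        using ijk del[of i] del[of j] del[of k] by auto
    qed
  qed
  have "inc_after n (delete_pos n p \<tau>) (p - 1)"
    unfolding inc_after_def
  proof (intro allI impI)
    fix i k assume ik: "p - 1 < i \<and> i < k \<and> k \<le> n"
    have "\<not> \<tau> (Suc k) < \<tau> (Suc i)"
    proof
      assume *: "\<tau> (Suc k) < \<tau> (Suc i)"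
      have "\<tau> (Suc i) \<noteq> \<tau> p"
        using ik p(1) by (auto simp: inj_eq[OF permutes_inj[OF per]])
      moreover have "\<tau> (Suc i) \<le> Suc n"
        using permutes_Icc_bounds(2)[OF per, of "Suc i"] ik by auto
      ultimately have "\<tau> (Suc i) < \<tau> p"
        using p(3) by simp
      moreover have "p < Suc i"
        using ik by arith
      ultimately show False
        using Av321D(2)[OF \<tau>, of p "Suc i" "Suc k"] * ik p(1) by auto
    qed
    moreover have "\<tau> (Suc k) \<noteq> \<tau> (Suc i)"
      using ik by (simp add: inj_eq[OF permutes_inj[OF per]])
    ultimately show "delete_pos n p \<tau> i < delete_pos n p \<tau> k"
      using ik by (auto simp: delete_pos_def)
  qed
  thus "last_desc n (delete_pos n p \<tau>) < p"
    using p(1) by (simp add: inc_after_iff)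
qed

text \<open>The inverse locates the maximum by \<open>inv \<tau> (Suc n)\<close> and deletes it; the
  admissible positions are exactly those behind the last descent.\<close>

lemma insert_max_bij:
  "bij_betw (\<lambda>(\<sigma>, p). insert_max n p \<sigma>)
     (SIGMA \<sigma>:Av321 n. {Suc (last_desc n \<sigma>)..Suc n}) (Av321 (Suc n))"
  (is "bij_betw ?f ?A ?B")
proof (rule bij_betw_byWitness[where f' = "\<lambda>\<tau>. (delete_pos n (inv \<tau> (Suc n)) \<tau>, inv \<tau> (Suc n))"])
  have invp: "1 \<le> inv \<tau> (Suc n) \<and> inv \<tau> (Suc n) \<le> Suc n \<and> \<tau> (inv \<tau> (Suc n)) = Suc n"
    if "\<tau> \<in> Av321 (Suc n)" for \<tau>
    using permutes_in_image[OF permutes_inv[OF Av321D(1)[OF that]], of "Suc n"]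
      permutes_inverses(1)[OF Av321D(1)[OF that]] by auto
  show "\<forall>a\<in>?A. (delete_pos n (inv (?f a) (Suc n)) (?f a), inv (?f a) (Suc n)) = a"
  proof
    fix a assume "a \<in> ?A"
    then obtain \<sigma> p where a: "a = (\<sigma>, p)" and \<sigma>: "\<sigma> \<in> Av321 n"
      and p: "p \<in> {Suc (last_desc n \<sigma>)..Suc n}"
      by blast
    define \<tau> where "\<tau> = insert_max n p \<sigma>"
    have per: "\<tau> permutes {1..Suc n}"
      unfolding \<tau>_def using Av321D(1)[OF \<sigma>] p by (intro insert_max_permutes) auto
    have "\<tau> p = Suc n" by (simp add: \<tau>_def insert_max_def)
    hence inv: "inv \<tau> (Suc n) = p"
      by (metis per permutes_inverses(2))
    have "delete_pos n p \<tau> i = \<sigma> i" for i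
      using p permutes_not_in[OF Av321D(1)[OF \<sigma>], of i]
      by (auto simp: \<tau>_def delete_pos_def insert_max_def)
    hence "(delete_pos n (inv \<tau> (Suc n)) \<tau>, inv \<tau> (Suc n)) = a"
      by (auto simp: inv a)
    thus "(delete_pos n (inv (?f a) (Suc n)) (?f a), inv (?f a) (Suc n)) = a"
      by (simp only: \<tau>_def a prod.case)
  qed
  show "\<forall>\<tau>\<in>?B. ?f (delete_pos n (inv \<tau> (Suc n)) \<tau>, inv \<tau> (Suc n)) = \<tau>"
  proof
    fix \<tau> assume \<tau>: "\<tau> \<in> ?B"
    have "insert_max n (inv \<tau> (Suc n)) (delete_pos n (inv \<tau> (Suc n)) \<tau>) i = \<tau> i" for i
      using invp[OF \<tau>] permutes_not_in[OF Av321D(1)[OF \<tau>], of i]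
      by (auto simp: insert_max_def delete_pos_def)
    thus "?f (delete_pos n (inv \<tau> (Suc n)) \<tau>, inv \<tau> (Suc n)) = \<tau>"
      by auto
  qed
  show "?f ` ?A \<subseteq> ?B"
    by (auto intro!: insert_max_Av321)
  show "(\<lambda>\<tau>. (delete_pos n (inv \<tau> (Suc n)) \<tau>, inv \<tau> (Suc n))) ` ?B \<subseteq> ?A"
    using invp delete_pos_Av321 by (auto simp: Suc_le_eq)
qed

text \<open>A maximum that is not placed last is followed by a smaller entry, and everything behind
  it increases; placed last, it creates no descent.\<close>

lemma last_desc_insert_max:
  assumes \<sigma>: "\<sigma> \<in> Av321 n" and p: "last_desc n \<sigma> < p" "p \<le> Suc n"
  shows "last_desc (Suc n) (insert_max n p \<sigma>) = (if p \<le> n then p else last_desc n \<sigma>)"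
proof (rule last_desc_eqI)
  fix e
  note per = Av321D(1)[OF \<sigma>]
  have inc: "\<sigma> i < \<sigma> k" if "p \<le> i" "i < k" "k \<le> n" for i k
    using p that inc_after_iff[of n \<sigma> "p - 1"] by (auto simp: inc_after_def)
  show "inc_after (Suc n) (insert_max n p \<sigma>) e \<longleftrightarrow> (if p \<le> n then p else last_desc n \<sigma>) \<le> e"
  proof (cases "p \<le> n")
    case True
    have "\<not> inc_after (Suc n) (insert_max n p \<sigma>) e" if "e < p"
    proof
      assume "inc_after (Suc n) (insert_max n p \<sigma>) e"
      hence "insert_max n p \<sigma> p < insert_max n p \<sigma> (Suc p)"
        using that True by (auto simp: inc_after_def)
      thus False
        using that True permutes_Icc_bounds(2)[OF per, of p] by (auto simp: insert_max_def)
    qed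
    moreover have "inc_after (Suc n) (insert_max n p \<sigma>) e" if "p \<le> e"
      using that inc by (auto simp: inc_after_def insert_max_def)
    ultimately show ?thesis using True by (auto simp: not_less[symmetric])
  next
    case False
    hence pn: "p = Suc n" using p by simp
    have "inc_after (Suc n) (insert_max n p \<sigma>) e \<longleftrightarrow> inc_after n \<sigma> e"
    proof
      assume *: "inc_after n \<sigma> e"
      show "inc_after (Suc n) (insert_max n p \<sigma>) e"
        unfolding inc_after_def
      proof (intro allI impI)
        fix i k assume ik: "e < i \<and> i < k \<and> k \<le> Suc n"
        thus "insert_max n p \<sigma> i < insert_max n p \<sigma> k"
          using * permutes_Icc_bounds(2)[OF per, of i]
          by (auto simp: insert_max_def pn inc_after_def)
      qed
    next
      assume *: "inc_after (Suc n) (insert_max n p \<sigma>) e"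
      show "inc_after n \<sigma> e"
        unfolding inc_after_def
      proof (intro allI impI)
        fix i k assume ik: "e < i \<and> i < k \<and> k \<le> n"
        hence "insert_max n p \<sigma> i < insert_max n p \<sigma> k"
          using * by (auto simp: inc_after_def)
        thus "\<sigma> i < \<sigma> k"
          using ik by (auto simp: insert_max_def pn)
      qed
    qed
    thus ?thesis using False by (simp add: inc_after_iff)
  qed
qed

section \<open>The generating tree of 321-avoiding permutations\<close>

lemma sum_Av321_Suc:
  fixes \<phi> :: "nat \<Rightarrow> nat"
  shows "(\<Sum>\<tau>\<in>Av321 (Suc n). \<phi> (Suc n - last_desc (Suc n) \<tau>))
       = (\<Sum>\<sigma>\<in>Av321 n. \<Sum>j\<in>{1..Suc (n - last_desc n \<sigma>)}. \<phi> j)"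
proof -
  have "(\<Sum>\<tau>\<in>Av321 (Suc n). \<phi> (Suc n - last_desc (Suc n) \<tau>))
      = (\<Sum>(\<sigma>, p)\<in>(SIGMA \<sigma>:Av321 n. {Suc (last_desc n \<sigma>)..Suc n}).
            \<phi> (Suc n - last_desc (Suc n) (insert_max n p \<sigma>)))"
    by (subst sum.reindex_bij_betw[OF insert_max_bij, symmetric]) (simp add: case_prod_beta)
  also have "\<dots> = (\<Sum>\<sigma>\<in>Av321 n. \<Sum>p\<in>{Suc (last_desc n \<sigma>)..Suc n}.
            \<phi> (Suc n - last_desc (Suc n) (insert_max n p \<sigma>)))"
    by (rule sum.Sigma[symmetric]) (auto simp: finite_Av321)
  also have "\<dots> = (\<Sum>\<sigma>\<in>Av321 n. \<Sum>j\<in>{1..Suc (n - last_desc n \<sigma>)}. \<phi> j)"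
  proof (rule sum.cong[OF refl])
    fix \<sigma> assume \<sigma>: "\<sigma> \<in> Av321 n"
    define d where "d = last_desc n \<sigma>"
    have d: "d \<le> n" by (simp add: d_def last_desc_le)
    have "(\<Sum>p\<in>{Suc d..Suc n}. \<phi> (Suc n - last_desc (Suc n) (insert_max n p \<sigma>)))
        = (\<Sum>p\<in>{Suc d..Suc n}. \<phi> (Suc n - (if p \<le> n then p else d)))"
      by (intro sum.cong refl) (simp add: last_desc_insert_max[OF \<sigma>] d_def)
    also have "\<dots> = (\<Sum>j\<in>{1..Suc (n - d)}. \<phi> j)"
      \<comment> \<open>A position \<open>p \<le> n\<close> yields the label
        \<open>Suc n - p\<close>, and these run through 1 to n - d; the last position keeps the old
        last descent and yields the remaining label \<open>Suc (n - d)\<close>.\<close>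
      by (rule sum.reindex_bij_witness[where
            i = "\<lambda>j. if j = Suc (n - d) then Suc n else Suc n - j" and
            j = "\<lambda>p. if p = Suc n then Suc (n - d) else Suc n - p"])
         (use d in \<open>auto split: if_splits simp: Suc_diff_le\<close>)
    finally show "(\<Sum>p\<in>{Suc (last_desc n \<sigma>)..Suc n}. \<phi> (Suc n - last_desc (Suc n) (insert_max n p \<sigma>)))
        = (\<Sum>j\<in>{1..Suc (n - last_desc n \<sigma>)}. \<phi> j)"
      by (simp add: d_def)
  qed
  finally show ?thesis .
qed

text \<open>Generations of the generating tree in which a node labelled \<open>L\<close> has children labelled
  \<open>1, \<dots>, L + 1\<close>; the label of a permutation is the length of its longest increasing suffix.\<close>
fun descendants :: "nat \<Rightarrow> nat \<Rightarrow> nat" where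
  "descendants L 0 = 1"
| "descendants L (Suc m) = (\<Sum>j\<in>{1..Suc L}. descendants j m)"

text \<open>Multiplying C = 1 + x C^2 by C^j gives x C^(j+2) = C^(j+1) - C^j, which telescopes over
  the children of a node; so a node labelled \<open>L\<close> has the generating function
  C^(L+1).\<close>

lemma descendants_eq: "real (descendants L m) = fps_nth (catF ^ Suc L) m"
proof (induction m arbitrary: L)
  case 0
  have "fps_nth catF 0 = 1" by (simp add: catF_def)
  thus ?case by (simp add: fps_power_zeroth)
next
  case (Suc m)
  have step: "fps_X * catF ^ Suc (Suc j) = catF ^ Suc j - catF ^ j" for j
  proof -
    have "catF ^ Suc j - catF ^ j = (catF - 1) * catF ^ j" by (simp add: algebra_simps)
    also have "catF - 1 = fps_X * catF * catF" using catF_eq by (simp add: algebra_simps)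
    finally show ?thesis by (simp add: algebra_simps)
  qed
  have "catF ^ Suc L - 1 = fps_X * (\<Sum>j\<in>{1..Suc L}. catF ^ Suc j)"
  proof (induction L)
    case 0
    show ?case using step[of 0] by simp
  next
    case (Suc L)
    have "fps_X * (\<Sum>j\<in>{1..Suc (Suc L)}. catF ^ Suc j) =
          fps_X * (\<Sum>j\<in>{1..Suc L}. catF ^ Suc j) + fps_X * catF ^ Suc (Suc (Suc L))"
      by (simp add: algebra_simps del: power_Suc)
    also have "\<dots> = catF ^ Suc (Suc L) - 1"
      by (subst Suc[symmetric], subst step) simp
    finally show ?case by simp
  qed
  hence "catF ^ Suc L = 1 + fps_X * (\<Sum>j\<in>{1..Suc L}. catF ^ Suc j)"
    by (simp add: algebra_simps)
  hence "fps_nth (catF ^ Suc L) (Suc m) = fps_nth (\<Sum>j\<in>{1..Suc L}. catF ^ Suc j) m"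
    by (simp del: power_Suc sum.cl_ivl_Suc)
  also have "\<dots> = (\<Sum>j\<in>{1..Suc L}. real (descendants j m))"
    by (simp add: fps_sum_nth Suc del: power_Suc sum.cl_ivl_Suc)
  finally show ?case by (simp del: power_Suc sum.cl_ivl_Suc)
qed

text \<open>The induction trades one level of permutations for one generation of descendants, until
  only the empty permutation with label 0 is left. The case \<open>m = 0\<close> then counts the
  avoiders.\<close>

lemma sum_descendants_Av321:
  "(\<Sum>\<sigma>\<in>Av321 n. descendants (n - last_desc n \<sigma>) m) = descendants 0 (n + m)"
proof (induction n arbitrary: m)
  case 0
  have "Av321 0 = {id}" by (auto simp: Av321_def)
  thus ?case by simp
next
  case (Suc n)
  have "(\<Sum>\<sigma>\<in>Av321 (Suc n). descendants (Suc n - last_desc (Suc n) \<sigma>) m)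
      = (\<Sum>\<sigma>\<in>Av321 n. descendants (n - last_desc n \<sigma>) (Suc m))"
    by (subst sum_Av321_Suc[of "\<lambda>L. descendants L m"]) simp
  thus ?case using Suc[of "Suc m"] by (simp only: add_Suc add_Suc_right)
qed

lemma card_Av321: "card (Av321 n) = cat n"
proof -
  have "card (Av321 n) = descendants 0 n"
    using sum_descendants_Av321[of n 0] by simp
  moreover have "real (descendants 0 n) = real (cat n)"
    by (simp add: descendants_eq catF_def)
  ultimately show ?thesis by simp
qed

section \<open>Splitting at fixed points\<close>

definition fixset :: "nat \<Rightarrow> (nat \<Rightarrow> nat) \<Rightarrow> nat set" where
  "fixset n \<tau> = {i \<in> {1..n}. \<tau> i = i}"

text \<open>A larger value to the left of \<open>s\<close> forces, by counting, a smaller value to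
  its right, and with \<open>s\<close> in the middle these form 321.\<close>

lemma Av321_fixed_point:
  assumes \<tau>: "\<tau> \<in> Av321 n" and s: "1 \<le> s" "s \<le> n" "\<tau> s = s"
  shows "\<And>i. i < s \<Longrightarrow> \<tau> i < s" "\<And>i. s < i \<Longrightarrow> s < \<tau> i"
proof -
  note per = Av321D(1)[OF \<tau>]
  note inj = inj_eq[OF permutes_inj[OF per]]
  have left: "\<tau> i < s" if i: "1 \<le> i" "i < s" for i
  proof (rule ccontr)
    assume "\<not> \<tau> i < s"
    with i s inj[of i s] have gt: "s < \<tau> i" by auto
    \<comment> \<open>Otherwise \<open>\<tau>\<close> maps the positions after \<open>s\<close> onto
      themselves, and the value \<open>\<tau> i\<close> would be taken twice.\<close>
    have "\<exists>k\<in>{Suc s..n}. \<tau> k < s"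
    proof (rule ccontr)
      assume *: "\<not> (\<exists>k\<in>{Suc s..n}. \<tau> k < s)"
      have "\<tau> ` {Suc s..n} \<subseteq> {Suc s..n}"
      proof (rule image_subsetI)
        fix k assume k: "k \<in> {Suc s..n}"
        thus "\<tau> k \<in> {Suc s..n}"
          using * s inj[of k s] permutes_Icc_bounds(2)[OF per, of k] by force
      qed
      hence "\<tau> ` {Suc s..n} = {Suc s..n}"
        by (intro endo_inj_surj) (auto simp: inj_on_def inj)
      moreover have "\<tau> i \<in> {Suc s..n}"
        using gt i s permutes_Icc_bounds(2)[OF per, of i] by auto
      ultimately obtain k where "k \<in> {Suc s..n}" "\<tau> i = \<tau> k"
        by (metis imageE)
      thus False using i by (simp add: inj)
    qed
    then obtain k where "k \<in> {Suc s..n}" "\<tau> k < s" by blast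
    thus False
      using Av321D(2)[OF \<tau>, of i s k] i s gt by auto
  qed
  have zero: "\<tau> 0 = 0" by (rule permutes_not_in[OF per]) simp
  show "\<tau> i < s" if "i < s" for i
    using that left[of i] zero s(1) by (cases "i = 0") auto
  \<comment> \<open>Hence \<open>\<tau>\<close> permutes the positions before \<open>s\<close>, and
    none of these values is left for a position after \<open>s\<close>.\<close>
  have "\<tau> ` {1..<s} \<subseteq> {1..<s}"
    using left permutes_Icc_bounds(1)[OF per] s by auto
  hence im: "\<tau> ` {1..<s} = {1..<s}"
    by (intro endo_inj_surj) (auto simp: inj_on_def inj)
  show "s < \<tau> i" if i: "s < i" for i
  proof (cases "i \<le> n")
    case True
    show ?thesis
    proof (rule ccontr)
      assume "\<not> s < \<tau> i"
      hence "\<tau> i \<in> {1..<s}"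
        using i s inj[of i s] permutes_Icc_bounds(1)[OF per, of i] True by auto
      then obtain k where "k \<in> {1..<s}" "\<tau> i = \<tau> k"
        using im by (metis imageE)
      thus False using i by (simp add: inj)
    qed
  next
    case False
    thus ?thesis using i permutes_not_in[OF per, of i] by auto
  qed
qed

section \<open>Direct sums around a fixed point\<close>

lemma trichotomy_Suc:
  obtains "i \<le> k" | "i = Suc k" | j where "i = Suc k + j" "1 \<le> j"
proof -
  consider "i \<le> k" | "i = Suc k" | "Suc k < i" by linarith
  thus thesis
    by cases (use that(1,2) that(3)[of "i - Suc k"] in auto)
qed

text \<open>The direct sum of \<open>\<sigma>\<close>, a single point and \<open>\<rho>\<close>. The
  middle point needs no clause of its own, since \<open>\<rho> 0 = 0\<close>.\<close>

definition glue :: "nat \<Rightarrow> (nat \<Rightarrow> nat) \<times> (nat \<Rightarrow> nat) \<Rightarrow> nat \<Rightarrow> nat" where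
  "glue k = (\<lambda>(\<sigma>, \<rho>) i. if i \<le> k then \<sigma> i else Suc k + \<rho> (i - Suc k))"

definition unglue :: "nat \<Rightarrow> (nat \<Rightarrow> nat) \<Rightarrow> (nat \<Rightarrow> nat) \<times> (nat \<Rightarrow> nat)" where
  "unglue k \<tau> = (\<lambda>i. if i \<le> k then \<tau> i else i, \<lambda>i. \<tau> (Suc k + i) - Suc k)"

text \<open>All values of a block lie below those of the next block, so a decreasing pattern stays
  within one block.\<close>

lemma glue_Av321:
  assumes \<sigma>: "\<sigma> \<in> Av321 k" and \<rho>: "\<rho> \<in> Av321 m"
  shows "glue k (\<sigma>, \<rho>) \<in> Av321 (Suc k + m)"
    and "glue k (\<sigma>, \<rho>) (Suc k) = Suc k"
    and "fixset (Suc k + m) (glue k (\<sigma>, \<rho>)) = fixset k \<sigma> \<union> {Suc k} \<union> (+) (Suc k) ` fixset m \<rho>"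
proof -
  note per\<sigma> = Av321D(1)[OF \<sigma>] and per\<rho> = Av321D(1)[OF \<rho>]
  note inj\<sigma> = inj_eq[OF permutes_inj[OF per\<sigma>]] and inj\<rho> = inj_eq[OF permutes_inj[OF per\<rho>]]
  have zero: "\<sigma> 0 = 0" "\<rho> 0 = 0"
    using permutes_not_in[OF per\<sigma>, of 0] permutes_not_in[OF per\<rho>, of 0] by auto
  have lo: "glue k (\<sigma>, \<rho>) i = \<sigma> i" "\<sigma> i \<le> k" if "i \<le> k" for i
    using that zero permutes_Icc_bounds(2)[OF per\<sigma>, of i] by (cases "i = 0"; auto simp: glue_def)+
  have hi: "glue k (\<sigma>, \<rho>) i = Suc k + \<rho> (i - Suc k)" if "k < i" for i
    using that by (auto simp: glue_def)
  show fixp: "glue k (\<sigma>, \<rho>) (Suc k) = Suc k"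
    by (simp add: glue_def zero)
  show "glue k (\<sigma>, \<rho>) \<in> Av321 (Suc k + m)"
  proof (rule Av321I)
    show "glue k (\<sigma>, \<rho>) permutes {1..Suc k + m}"
    proof (rule permutes_finiteI)
      show "inj_on (glue k (\<sigma>, \<rho>)) {1..Suc k + m}"
      proof (rule inj_onI)
        fix x y assume e: "glue k (\<sigma>, \<rho>) x = glue k (\<sigma>, \<rho>) y"
        show "x = y"
          by (cases "x \<le> k"; cases "y \<le> k")
             (use e lo[of x] lo[of y] hi[of x] hi[of y] inj\<sigma>[of x y] inj\<rho>[of "x - Suc k" "y - Suc k"] in auto)
      qed
      show "glue k (\<sigma>, \<rho>) ` {1..Suc k + m} \<subseteq> {1..Suc k + m}"
      proof (rule image_subsetI)
        fix x assume x: "x \<in> {1..Suc k + m}"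
        show "glue k (\<sigma>, \<rho>) x \<in> {1..Suc k + m}"
        proof (cases "x \<le> k")
          case True
          thus ?thesis using x lo[of x] permutes_Icc_bounds(1)[OF per\<sigma>, of x] by auto
        next
          case False
          hence "\<rho> (x - Suc k) \<le> m"
            using x zero permutes_Icc_bounds(2)[OF per\<rho>, of "x - Suc k"] by (cases "x = Suc k") auto
          thus ?thesis using False hi[of x] by auto
        qed
      qed
      show "glue k (\<sigma>, \<rho>) x = x" if "x \<notin> {1..Suc k + m}" for x
      proof (cases "x = 0")
        case False
        hence "Suc k + m < x" using that by auto
        moreover from this have "\<rho> (x - Suc k) = x - Suc k"
          by (intro permutes_not_in[OF per\<rho>]) auto
        ultimately show ?thesis by (simp add: glue_def)
      qed (simp add: glue_def zero)
    qed simp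
  next
    fix i j l
    assume A: "1 \<le> i" "i < j" "j < l" "l \<le> Suc k + m"
      "glue k (\<sigma>, \<rho>) j < glue k (\<sigma>, \<rho>) i" "glue k (\<sigma>, \<rho>) l < glue k (\<sigma>, \<rho>) j"
    show False
    proof (cases "l \<le> k")
      case True
      thus False
        using A lo[of i] lo[of j] lo[of l] Av321D(2)[OF \<sigma>, of i j l] by auto
    next
      case False
      hence "k < j" using A lo[of j] hi[of l] by (cases "j \<le> k") auto
      hence "k < i" using A lo[of i] hi[of j] by (cases "i \<le> k") auto
      hence "i \<noteq> Suc k" using A hi[of j] \<open>k < j\<close> fixp by auto
      thus False
        using A False \<open>k < i\<close> \<open>k < j\<close> hi[of i] hi[of j] hi[of l]
        by (intro Av321D(2)[OF \<rho>, of "i - Suc k" "j - Suc k" "l - Suc k"]) auto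
    qed
  qed
  show "fixset (Suc k + m) (glue k (\<sigma>, \<rho>)) = fixset k \<sigma> \<union> {Suc k} \<union> (+) (Suc k) ` fixset m \<rho>"
    (is "?L = ?R")
  proof (rule set_eqI)
    fix i
    consider "i \<le> k" | "i = Suc k" | j where "i = Suc k + j" "1 \<le> j"
      by (rule trichotomy_Suc)
    thus "i \<in> ?L \<longleftrightarrow> i \<in> ?R"
    proof cases
      case 1
      thus ?thesis using lo[of i] by (auto simp: fixset_def)
    next
      case 2
      thus ?thesis using fixp by (auto simp: fixset_def)
    next
      case 3
      thus ?thesis using hi[of i] by (auto simp: fixset_def image_iff)
    qed
  qed
qed

lemma unglue_Av321:
  assumes \<tau>: "\<tau> \<in> Av321 (Suc k + m)" and fp: "\<tau> (Suc k) = Suc k"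
  shows "unglue k \<tau> \<in> Av321 k \<times> Av321 m" "glue k (unglue k \<tau>) = \<tau>"
proof -
  note per = Av321D(1)[OF \<tau>]
  note inj = inj_eq[OF permutes_inj[OF per]]
  have lo: "\<tau> i \<le> k" if "i \<le> k" for i
    using Av321_fixed_point(1)[OF \<tau> _ _ fp, of i] that by auto
  have hi: "Suc k < \<tau> i" if "Suc k < i" for i
    using Av321_fixed_point(2)[OF \<tau> _ _ fp, of i] that by auto
  have hi': "Suc k \<le> \<tau> (Suc (k + i))" for i
    using hi[of "Suc (k + i)"] fp by (cases "i = 0") auto
  have "fst (unglue k \<tau>) \<in> Av321 k"
  proof (rule Av321I)
    show "fst (unglue k \<tau>) permutes {1..k}"
    proof (rule permutes_finiteI)
      show "inj_on (fst (unglue k \<tau>)) {1..k}"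
        by (auto simp: inj_on_def unglue_def inj)
      show "fst (unglue k \<tau>) ` {1..k} \<subseteq> {1..k}"
        using lo permutes_Icc_bounds(1)[OF per] by (auto simp: unglue_def)
      show "fst (unglue k \<tau>) x = x" if "x \<notin> {1..k}" for x
        using that permutes_not_in[OF per, of 0] by (cases "x = 0") (auto simp: unglue_def)
    qed simp
  next
    fix i j l
    assume "1 \<le> i" "i < j" "j < l" "l \<le> k"
      "fst (unglue k \<tau>) j < fst (unglue k \<tau>) i" "fst (unglue k \<tau>) l < fst (unglue k \<tau>) j"
    thus False
      using Av321D(2)[OF \<tau>, of i j l] by (auto simp: unglue_def)
  qed
  moreover have "snd (unglue k \<tau>) \<in> Av321 m"
  proof (rule Av321I)
    show "snd (unglue k \<tau>) permutes {1..m}"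
    proof (rule permutes_finiteI)
      show "inj_on (snd (unglue k \<tau>)) {1..m}"
      proof (rule inj_onI)
        fix x y assume "snd (unglue k \<tau>) x = snd (unglue k \<tau>) y"
        hence "\<tau> (Suc k + x) = \<tau> (Suc k + y)"
          using hi'[of x] hi'[of y] by (simp add: unglue_def)
        thus "x = y" by (simp add: inj)
      qed
      show "snd (unglue k \<tau>) ` {1..m} \<subseteq> {1..m}"
      proof (rule image_subsetI)
        fix x assume "x \<in> {1..m}"
        thus "snd (unglue k \<tau>) x \<in> {1..m}"
          using hi[of "Suc k + x"] permutes_Icc_bounds(2)[OF per, of "Suc k + x"]
          by (auto simp: unglue_def)
      qed
      show "snd (unglue k \<tau>) x = x" if "x \<notin> {1..m}" for x
        using that fp permutes_not_in[OF per, of "Suc k + x"] by (cases "x = 0") (auto simp: unglue_def)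
    qed simp
  next
    fix i j l
    assume "1 \<le> i" "i < j" "j < l" "l \<le> m"
      "snd (unglue k \<tau>) j < snd (unglue k \<tau>) i" "snd (unglue k \<tau>) l < snd (unglue k \<tau>) j"
    thus False
      by (intro Av321D(2)[OF \<tau>, of "Suc k + i" "Suc k + j" "Suc k + l"]) (auto simp: unglue_def)
  qed
  ultimately show "unglue k \<tau> \<in> Av321 k \<times> Av321 m"
    by (auto simp: mem_Times_iff)
  show "glue k (unglue k \<tau>) = \<tau>"
  proof
    fix i
    show "glue k (unglue k \<tau>) i = \<tau> i"
      using hi'[of "i - Suc k"] by (auto simp: glue_def unglue_def)
  qed
qed

lemma glue_bij:
  "bij_betw (glue k) (Av321 k \<times> Av321 m) {\<tau> \<in> Av321 (Suc k + m). \<tau> (Suc k) = Suc k}"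
proof (rule bij_betw_byWitness[where f' = "unglue k"])
  show "\<forall>a\<in>Av321 k \<times> Av321 m. unglue k (glue k a) = a"
  proof
    fix a assume "a \<in> Av321 k \<times> Av321 m"
    then obtain \<sigma> \<rho> where a: "a = (\<sigma>, \<rho>)" "\<sigma> \<in> Av321 k" by blast
    have "\<sigma> i = i" if "\<not> i \<le> k" for i
      using that permutes_not_in[OF Av321D(1)[OF a(2)], of i] by auto
    thus "unglue k (glue k a) = a"
      by (auto simp: a unglue_def glue_def)
  qed
  show "\<forall>\<tau>\<in>{\<tau> \<in> Av321 (Suc k + m). \<tau> (Suc k) = Suc k}. glue k (unglue k \<tau>) = \<tau>"
    using unglue_Av321(2) by blast
  show "glue k ` (Av321 k \<times> Av321 m) \<subseteq> {\<tau> \<in> Av321 (Suc k + m). \<tau> (Suc k) = Suc k}"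
    using glue_Av321(1,2) by blast
  show "unglue k ` {\<tau> \<in> Av321 (Suc k + m). \<tau> (Suc k) = Suc k} \<subseteq> Av321 k \<times> Av321 m"
    using unglue_Av321(1) by blast
qed

text \<open>The two blocks are chosen freely, so conditions on the fixed points on either side
  multiply. Arbitrary \<open>P\<close> and \<open>Q\<close> serve both prescribed sets and, with
  \<open>Q\<close> always true, the decomposition by the first fixed point.\<close>

lemma card_split_fixed_point:
  "card {\<tau> \<in> Av321 (Suc k + m). \<tau> (Suc k) = Suc k \<and> P (fixset (Suc k + m) \<tau> \<inter> {..k})
      \<and> Q {i \<in> {1..}. Suc k + i \<in> fixset (Suc k + m) \<tau>}}
   = card {\<sigma> \<in> Av321 k. P (fixset k \<sigma>)} * card {\<rho> \<in> Av321 m. Q (fixset m \<rho>)}"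
  (is "card ?L = card ?A * card ?B")
proof -
  have "bij_betw (glue k) (?A \<times> ?B) (glue k ` (?A \<times> ?B))"
    by (rule bij_betw_subset[OF glue_bij]) auto
  moreover have "glue k ` (?A \<times> ?B) = ?L"
  proof -
    have parts: "fixset (Suc k + m) (glue k (\<sigma>, \<rho>)) \<inter> {..k} = fixset k \<sigma>"
      "{i \<in> {1..}. Suc k + i \<in> fixset (Suc k + m) (glue k (\<sigma>, \<rho>))} = fixset m \<rho>"
      if "\<sigma> \<in> Av321 k" "\<rho> \<in> Av321 m" for \<sigma> \<rho>
      unfolding glue_Av321(3)[OF that] by (auto simp: fixset_def)
    show ?thesis
    proof (intro equalityI subsetI)
      fix \<tau> assume "\<tau> \<in> glue k ` (?A \<times> ?B)"
      then obtain \<sigma> \<rho> where *: "\<tau> = glue k (\<sigma>, \<rho>)" "\<sigma> \<in> Av321 k" "\<rho> \<in> Av321 m"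
        "P (fixset k \<sigma>)" "Q (fixset m \<rho>)" by blast
      thus "\<tau> \<in> ?L"
        using glue_Av321(1,2)[OF *(2,3)] by (simp only: parts mem_Collect_eq)
    next
      fix \<tau> assume \<tau>: "\<tau> \<in> ?L"
      obtain \<sigma> \<rho> where u: "unglue k \<tau> = (\<sigma>, \<rho>)" by (cases "unglue k \<tau>")
      have *: "\<tau> = glue k (\<sigma>, \<rho>)" "\<sigma> \<in> Av321 k" "\<rho> \<in> Av321 m"
        using unglue_Av321[of \<tau> k m] \<tau> by (auto simp: u)
      have "P (fixset k \<sigma>)" "Q (fixset m \<rho>)"
        using \<tau> unfolding *(1) mem_Collect_eq parts[OF *(2,3)] by auto
      thus "\<tau> \<in> glue k ` (?A \<times> ?B)"
        using * by blast
    qed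
  qed
  ultimately show ?thesis
    using bij_betw_same_card[of "glue k" "?A \<times> ?B" ?L] by (simp only: card_cartesian_product)
qed

section \<open>Fine numbers and their generating function\<close>

definition nfix :: "nat \<Rightarrow> nat set \<Rightarrow> nat" where
  "nfix n A = card {\<tau> \<in> Av321 n. fixset n \<tau> = A}"

abbreviation fine_num :: "nat \<Rightarrow> nat" where
  "fine_num n \<equiv> nfix n {}"

lemma nfix_split:
  assumes "A \<subseteq> {1..k}" "0 \<notin> B"
  shows "nfix (Suc k + m) (A \<union> {Suc k} \<union> (+) (Suc k) ` B) = nfix k A * nfix m B"
proof -
  have "{\<tau> \<in> Av321 (Suc k + m). fixset (Suc k + m) \<tau> = A \<union> {Suc k} \<union> (+) (Suc k) ` B}
     = {\<tau> \<in> Av321 (Suc k + m). \<tau> (Suc k) = Suc k \<and> fixset (Suc k + m) \<tau> \<inter> {..k} = A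
      \<and> {i \<in> {1..}. Suc k + i \<in> fixset (Suc k + m) \<tau>} = B}" (is "{\<tau> \<in> _. ?P \<tau>} = {\<tau> \<in> _. ?Q \<tau>}")
  proof (rule Collect_cong, rule conj_cong[OF refl])
    fix \<tau>
    define F where "F = fixset (Suc k + m) \<tau>"
    have fp: "\<tau> (Suc k) = Suc k \<longleftrightarrow> Suc k \<in> F"
      by (auto simp: F_def fixset_def)
    have F0: "0 \<notin> F" by (auto simp: F_def fixset_def)
    have "F = A \<union> {Suc k} \<union> (+) (Suc k) ` B \<longleftrightarrow>
      Suc k \<in> F \<and> F \<inter> {..k} = A \<and> {i \<in> {1..}. Suc k + i \<in> F} = B" (is "?l \<longleftrightarrow> ?r")
    proof
      assume ?l
      thus ?r using assms by auto (metis One_nat_def Suc_leI neq0_conv)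
    next
      assume r: ?r
      have "i \<in> F \<longleftrightarrow> i \<in> A \<union> {Suc k} \<union> (+) (Suc k) ` B" for i
      proof -
        consider "i \<le> k" | "i = Suc k" | j where "i = Suc k + j" "1 \<le> j"
          by (rule trichotomy_Suc)
        thus ?thesis
        proof cases
          case 1
          hence "i \<in> F \<longleftrightarrow> i \<in> A" using r by auto
          thus ?thesis using 1 by auto
        next
          case 2
          thus ?thesis using r by auto
        next
          case 3
          hence "i \<in> F \<longleftrightarrow> j \<in> B" using r by auto
          moreover have "i \<notin> A" using assms(1) 3 by auto
          ultimately show ?thesis using 3 by auto
        qed
      qed
      thus ?l by blast
    qed
    thus "?P \<tau> \<longleftrightarrow> ?Q \<tau>" unfolding fp F_def .
  qed
  thus ?thesis
    using card_split_fixed_point[of k m "\<lambda>F. F = A" "\<lambda>F. F = B"] by (simp add: nfix_def)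
qed

text \<open>Sorts by the first fixed point \<open>Suc k\<close>: a derangement of size
  \<open>k\<close> stands before it, an arbitrary avoider behind it.\<close>

lemma cat_first_fixed_point: "cat n = fine_num n + (\<Sum>k<n. fine_num k * cat (n - Suc k))"
proof -
  define first where "first k = {\<tau> \<in> Av321 n. \<tau> (Suc k) = Suc k \<and> fixset n \<tau> \<inter> {..k} = {}}" for k
  have card_first: "card (first k) = fine_num k * cat (n - Suc k)" if "k < n" for k
  proof -
    have "Suc k \<le> n" using that by simp
    then obtain m where m: "n = Suc k + m" using le_Suc_ex by blast
    show ?thesis
      using card_split_fixed_point[of k m "\<lambda>F. F = {}" "\<lambda>_. True"]
      by (simp add: first_def m nfix_def card_Av321)
  qed
  have "Av321 n = {\<tau> \<in> Av321 n. fixset n \<tau> = {}} \<union> (\<Union>k\<in>{..<n}. first k)" (is "_ = ?R")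
  proof (intro equalityI subsetI)
    fix \<tau> assume \<tau>: "\<tau> \<in> Av321 n"
    show "\<tau> \<in> ?R"
    proof (cases "fixset n \<tau> = {}")
      case False
      define s where "s = Min (fixset n \<tau>)"
      have fin: "finite (fixset n \<tau>)" by (simp add: fixset_def)
      have s: "s \<in> fixset n \<tau>" unfolding s_def using fin False by simp
      have least: "s \<le> i" if "i \<in> fixset n \<tau>" for i
        unfolding s_def using fin that by simp
      obtain k where k: "s = Suc k" using s by (cases s) (auto simp: fixset_def)
      have "k < n" "\<tau> \<in> first k"
        using s \<tau> least by (force simp: first_def k fixset_def)+
      thus ?thesis by blast
    qed (use \<tau> in auto)
  qed (auto simp: first_def)
  hence "card (Av321 n) = card {\<tau> \<in> Av321 n. fixset n \<tau> = {}} + card (\<Union>k\<in>{..<n}. first k)"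
    by (subst card_Un_disjoint[symmetric]) (auto simp: finite_Av321 first_def fixset_def)
  also have "card (\<Union>k\<in>{..<n}. first k) = (\<Sum>k<n. card (first k))"
  proof (intro card_UN_disjoint ballI impI)
    fix i j :: nat assume ij: "i \<in> {..<n}" "j \<in> {..<n}" "i \<noteq> j"
    have "first i \<inter> first j = {}" if "i < j" "j < n" for i j
    proof -
      have False if "\<tau> \<in> first i" "\<tau> \<in> first j" for \<tau>
      proof -
        have "Suc i \<in> fixset n \<tau> \<inter> {..j}"
          using that(1) \<open>i < j\<close> \<open>j < n\<close> by (auto simp: first_def fixset_def)
        thus False using that(2) by (auto simp: first_def)
      qed
      thus ?thesis by blast
    qed
    thus "first i \<inter> first j = {}"
      using ij by (metis Int_commute lessThan_iff linorder_neqE_nat)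
  qed (auto simp: first_def finite_Av321)
  finally show ?thesis
    by (simp add: card_Av321 nfix_def[symmetric] card_first)
qed

definition fineF :: "real fps" where
  "fineF = Abs_fps (\<lambda>n. real (fine_num n))"

lemma catF_fineF: "catF = fineF * (1 + fps_X * catF)"
proof (rule fps_ext)
  fix n
  have "fps_nth (fps_X * (fineF * catF)) n = (\<Sum>k<n. real (fine_num k * cat (n - Suc k)))"
  proof (cases n)
    case (Suc m)
    have "fps_nth (fps_X * (fineF * catF)) n = fps_nth (fineF * catF) m"
      by (simp add: Suc)
    thus ?thesis
      by (simp add: Suc fps_mult_nth fineF_def catF_def lessThan_Suc_atMost atLeast0AtMost)
  qed simp
  hence "fps_nth (fineF + fps_X * (fineF * catF)) n = real (cat n)"
    by (subst cat_first_fixed_point) (simp add: fineF_def)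
  thus "fps_nth catF n = fps_nth (fineF * (1 + fps_X * catF)) n"
    by (simp add: catF_def algebra_simps)
qed

lemma one_plus_X_catF_nz: "1 + fps_X * catF \<noteq> 0"
proof
  assume "1 + fps_X * catF = 0"
  hence "fps_nth (1 + fps_X * catF) 0 = 0" by simp
  thus False by simp
qed

text \<open>This is (2 + x) F = 1 + C in coefficients. As C = 1 + x C^2, the series (2 + x) C
  factors as (1 + x C)(1 + C), and C = F (1 + x C) lets 1 + x C cancel.\<close>

lemma cat_eq_fine: "real (cat (Suc n)) = 2 * real (fine_num (Suc n)) + real (fine_num n)"
proof -
  have "(1 + fps_X * catF) * ((2 + fps_X) * fineF)
      = (2 + fps_X) * (fineF * (1 + fps_X * catF))"
    by (simp only: ac_simps)
  also have "\<dots> = (2 + fps_X) * catF"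
    by (simp only: catF_fineF[symmetric])
  also have "\<dots> = (1 + fps_X * catF) * (1 + catF)"
    using catF_eq by (simp add: algebra_simps)
  finally have "(2 + fps_X) * fineF = 1 + catF"
    using one_plus_X_catF_nz by simp
  hence "fps_const 2 * fineF + fps_X * fineF = 1 + catF"
    by (simp add: algebra_simps numeral_fps_const)
  hence "fps_nth (fps_const 2 * fineF + fps_X * fineF) (Suc n) = fps_nth (1 + catF) (Suc n)"
    by simp
  thus ?thesis
    by (simp add: fineF_def catF_def)
qed

text \<open>This is F = 1 + x (C - 1) F in coefficients. The factor x (C - 1) counts trees with at
  least two vertices by size, so the same recursion governs the first tree inside a gap.\<close>

lemma fine_rec:
  "real (fine_num k) = of_bool (k = 0) + (\<Sum>s=2..k. real (cat (s - 1)) * real (fine_num (k - s)))"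
proof -
  define G where "G = fps_X * (catF - 1)"
  have "(1 + fps_X * catF) * (1 + G * fineF)
      = 1 + fps_X * catF + G * (fineF * (1 + fps_X * catF))"
    by (simp add: algebra_simps)
  also have "\<dots> = 1 + fps_X * catF + G * catF"
    by (simp only: catF_fineF[symmetric])
  also have "\<dots> = catF"
    using catF_eq by (simp add: G_def algebra_simps)
  also have "\<dots> = (1 + fps_X * catF) * fineF"
    by (subst catF_fineF) (simp only: ac_simps)
  finally have "fineF = 1 + G * fineF"
    using one_plus_X_catF_nz by simp
  hence "fps_nth fineF k = fps_nth (1 + G * fineF) k"
    by simp
  hence "real (fine_num k) = of_bool (k = 0) + (\<Sum>s=0..k. fps_nth G s * real (fine_num (k - s)))"
    by (simp add: fineF_def fps_mult_nth)
  also have "(\<Sum>s=0..k. fps_nth G s * real (fine_num (k - s)))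
      = (\<Sum>s=2..k. real (cat (s - 1)) * real (fine_num (k - s)))"
    by (rule sum.mono_neutral_cong_right) (auto simp: G_def catF_def not_le numeral_2_eq_2 less_Suc_eq)
  finally show ?thesis .
qed

section \<open>Limit of the ratio of Fine to Catalan numbers\<close>

lemma contraction_tendsto_0:
  fixes e \<delta> :: "nat \<Rightarrow> real"
  assumes "\<And>n. 0 \<le> e n" "\<And>n. e (Suc n) \<le> e n / 2 + \<delta> n" "\<delta> \<longlonglongrightarrow> 0"
  shows "e \<longlonglongrightarrow> 0"
proof (rule LIMSEQ_I)
  fix r :: real assume r: "0 < r"
  obtain n0 where n0: "\<And>n. n \<ge> n0 \<Longrightarrow> \<bar>\<delta> n\<bar> < r / 4"
    using LIMSEQ_D[OF assms(3), of "r / 4"] r by auto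
  \<comment> \<open>Each step halves the error and adds at most r/4; the additions sum to at most
    r/2.\<close>
  have bound: "e (n0 + k) \<le> e n0 * (1/2) ^ k + r / 2" for k
  proof (induction k)
    case (Suc k)
    have "e (n0 + Suc k) \<le> e (n0 + k) / 2 + r / 4"
      using assms(2)[of "n0 + k"] n0[of "n0 + k"] by auto
    also have "\<dots> \<le> (e n0 * (1/2) ^ k + r / 2) / 2 + r / 4"
      using Suc by simp
    finally show ?case by (simp add: field_simps)
  qed (use r in simp)
  have "(\<lambda>k. e n0 * (1/2) ^ k) \<longlonglongrightarrow> e n0 * 0"
    by (intro tendsto_mult tendsto_const LIMSEQ_power_zero) simp
  then obtain k0 where k0: "\<And>k. k \<ge> k0 \<Longrightarrow> \<bar>e n0 * (1/2) ^ k\<bar> < r / 2"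
    using LIMSEQ_D[of "\<lambda>k. e n0 * (1/2) ^ k" 0 "r / 2"] r by auto
  show "\<exists>no. \<forall>n\<ge>no. norm (e n - 0) < r"
  proof (intro exI allI impI)
    fix n assume n: "n0 + k0 \<le> n"
    have "e n < r"
      using bound[of "n - n0"] abs_le_D1[OF less_imp_le[OF k0[of "n - n0"]]] n k0[of "n - n0"] by force
    thus "norm (e n - 0) < r" using assms(1)[of n] by simp
  qed
qed

text \<open>Dividing \<open>cat_eq_fine\<close> by C_(n+1) shows that the ratio r is followed by 1/2
  - r q / 2 with q = C_n / C_(n+1), and 4/9 is the fixed point at q = 1/4. As q is at most 1, the
  map contracts by 1/2, up to a multiple of q - 1/4 that tends to 0.\<close>

lemma fine_cat_ratio: "(\<lambda>n. real (fine_num n) / real (cat n)) \<longlonglongrightarrow> 4 / 9"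
proof -
  define q where "q n = real (cat n) / real (cat (Suc n))" for n
  define r where "r n = real (fine_num n) / real (cat n)" for n
  have pos: "0 < real (cat n)" for n using cat_pos by simp
  have rec: "r (Suc n) = 1 / 2 - r n * q n / 2" for n
    using cat_eq_fine[of n] pos[of n] pos[of "Suc n"] by (simp add: r_def q_def field_simps)
  have q1: "0 \<le> q n" "q n \<le> 1" for n
  proof -
    have "real (n + 2) * real (cat n) \<le> real (n + 2) * real (cat (Suc n))"
      unfolding cat_rec using pos[of n] by (intro mult_right_mono) auto
    hence "real (cat n) \<le> real (cat (Suc n))"
      by (subst (asm) mult_le_cancel_left_pos) auto
    thus "0 \<le> q n" "q n \<le> 1"
      using pos[of n] pos[of "Suc n"] by (auto simp: q_def divide_simps)
  qed
  have q: "q \<longlonglongrightarrow> 1 / 4" unfolding q_def by (rule cat_ratio)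
  have "(\<lambda>n. \<bar>r n - 4 / 9\<bar>) \<longlonglongrightarrow> 0"
  proof (rule contraction_tendsto_0)
    have "(\<lambda>n. 2 / 9 * \<bar>q n - 1 / 4\<bar>) \<longlonglongrightarrow> 2 / 9 * \<bar>1 / 4 - 1 / 4\<bar>"
      by (intro tendsto_intros q)
    thus "(\<lambda>n. 2 / 9 * \<bar>q n - 1 / 4\<bar>) \<longlonglongrightarrow> 0" by simp
    fix n
    have "r (Suc n) - 4 / 9 = - (q n / 2 * (r n - 4 / 9) + 2 / 9 * (q n - 1 / 4))"
      by (simp add: rec field_simps)
    hence "\<bar>r (Suc n) - 4 / 9\<bar> \<le> \<bar>q n / 2 * (r n - 4 / 9)\<bar> + \<bar>2 / 9 * (q n - 1 / 4)\<bar>"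
      by (simp only: abs_minus_cancel abs_triangle_ineq)
    also have "\<bar>q n / 2 * (r n - 4 / 9)\<bar> = q n * (\<bar>r n - 4 / 9\<bar> / 2)"
      using q1(1)[of n] by (simp add: abs_mult)
    also have "\<dots> \<le> 1 * (\<bar>r n - 4 / 9\<bar> / 2)"
      using q1[of n] by (intro mult_right_mono) auto
    also have "\<bar>2 / 9 * (q n - 1 / 4)\<bar> = 2 / 9 * \<bar>q n - 1 / 4\<bar>"
      by (simp only: abs_mult abs_divide abs_numeral)
    finally show "\<bar>r (Suc n) - 4 / 9\<bar> \<le> \<bar>r n - 4 / 9\<bar> / 2 + 2 / 9 * \<bar>q n - 1 / 4\<bar>"
      by simp
  qed simp
  hence "(\<lambda>n. r n - 4 / 9) \<longlonglongrightarrow> 0"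
    by (rule tendsto_rabs_zero_cancel)
  hence "(\<lambda>n. r n - 4 / 9 + 4 / 9) \<longlonglongrightarrow> 0 + 4 / 9"
    by (intro tendsto_add tendsto_const)
  thus ?thesis by (simp add: r_def)
qed

lemma fine_cat_ratio_diff: "(\<lambda>n. real (fine_num (n - a)) / real (cat n)) \<longlonglongrightarrow> 4 / 9 * (1 / 4) ^ a"
proof (rule LIMSEQ_offset[where k = a])
  have "(\<lambda>n. real (fine_num n) / real (cat n) * (real (cat n) / real (cat (n + a))))
      \<longlonglongrightarrow> 4 / 9 * (1 / 4) ^ a"
    by (intro tendsto_mult fine_cat_ratio cat_ratio_add)
  thus "(\<lambda>n. real (fine_num (n + a - a)) / real (cat (n + a))) \<longlonglongrightarrow> 4 / 9 * (1 / 4) ^ a"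
    using cat_pos by (simp add: less_imp_neq[THEN not_sym])
qed

section \<open>Configurations encoded by gap lists\<close>

text \<open>Encodes a finite set of positive integers by the numbers of points skipped before each
  element. The list form gives induction on the first gap, for permutations and for tree sizes
  alike.\<close>

fun gapset :: "nat list \<Rightarrow> nat set" where
  "gapset [] = {}"
| "gapset (k # g) = insert (Suc k) ((+) (Suc k) ` gapset g)"

fun gaplen :: "nat list \<Rightarrow> nat" where
  "gaplen [] = 0"
| "gaplen (k # g) = Suc k + gaplen g"

definition gapprod :: "nat list \<Rightarrow> nat" where
  "gapprod g = prod_list (map fine_num g)"

lemma gapprod_simps [simp]: "gapprod [] = 1" "gapprod (k # g) = fine_num k * gapprod g"
  by (simp_all add: gapprod_def)

lemma gapset_bounds: "gapset g \<subseteq> {1..gaplen g}"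
  by (induction g) auto

lemma zero_notin_gapset: "0 \<notin> gapset g"
  using gapset_bounds[of g] by auto

lemma nfix_gapset_left:
  "0 \<notin> B \<Longrightarrow> nfix (gaplen g + m) (gapset g \<union> (+) (gaplen g) ` B) = gapprod g * nfix m B"
proof (induction g)
  case (Cons k g)
  have "gapset (k # g) \<union> (+) (gaplen (k # g)) ` B
      = {} \<union> {Suc k} \<union> (+) (Suc k) ` (gapset g \<union> (+) (gaplen g) ` B)"
    by (simp add: image_Un image_image add.assoc)
  moreover have "gaplen (k # g) + m = Suc k + (gaplen g + m)" by simp
  ultimately have "nfix (gaplen (k # g) + m) (gapset (k # g) \<union> (+) (gaplen (k # g)) ` B)
      = fine_num k * nfix (gaplen g + m) (gapset g \<union> (+) (gaplen g) ` B)"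
    using Cons.prems zero_notin_gapset[of g] nfix_split[of "{}" k "gapset g \<union> (+) (gaplen g) ` B"]
    by (metis (no_types, lifting) UnE add_eq_0_iff_both_eq_0 empty_subsetI imageE)
  thus ?case using Cons by simp
qed simp

text \<open>The list \<open>h\<close> is read from the right end, so its head \<open>k\<close> is
  the outermost gap and splits off as a final block without fixed points.\<close>

lemma nfix_gapset_right:
  "A \<subseteq> {1..m} \<Longrightarrow>
     nfix (m + gaplen h) (A \<union> (\<lambda>x. m + gaplen h + 1 - x) ` gapset h) = nfix m A * gapprod h"
proof (induction h)
  case (Cons k h)
  define n where "n = m + gaplen h"
  define A' where "A' = A \<union> (\<lambda>x. n + 1 - x) ` gapset h"
  have len: "m + gaplen (k # h) = Suc n + k" by (simp add: n_def)
  have "A \<union> (\<lambda>x. Suc n + k + 1 - x) ` gapset (k # h) = A' \<union> {Suc n} \<union> (+) (Suc n) ` {}"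
    by (auto simp: A'_def image_image)
  moreover have "A' \<subseteq> {1..n}"
    using Cons.prems gapset_bounds[of h] by (force simp: A'_def n_def)
  ultimately have "nfix (Suc n + k) (A \<union> (\<lambda>x. Suc n + k + 1 - x) ` gapset (k # h)) = nfix n A' * fine_num k"
    by (simp only: nfix_split[of A' n "{}" k] empty_iff not_False_eq_True)
  thus ?case
    unfolding len using Cons by (simp add: n_def A'_def)
qed simp

text \<open>Only the central gap, between the two groups of fixed points, varies with
  \<open>n\<close>; it carries all of the asymptotics.\<close>

lemma nfix_gapsets:
  assumes n: "gaplen g + gaplen h \<le> n"
  shows "nfix n (gapset g \<union> (\<lambda>x. n + 1 - x) ` gapset h)
       = gapprod g * gapprod h * fine_num (n - (gaplen g + gaplen h))"
proof -
  define m where "m = n - (gaplen g + gaplen h)"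
  define B where "B = (\<lambda>x. m + gaplen h + 1 - x) ` gapset h"
  have n_eq: "n = gaplen g + (m + gaplen h)" using n by (simp add: m_def)
  have B: "0 \<notin> B" using gapset_bounds[of h] by (force simp: B_def)
  have "(\<lambda>x. n + 1 - x) ` gapset h = (+) (gaplen g) ` B"
    unfolding B_def image_image
    by (rule image_cong[OF refl]) (use gapset_bounds[of h] in \<open>force simp: n_eq\<close>)
  hence "nfix n (gapset g \<union> (\<lambda>x. n + 1 - x) ` gapset h) = gapprod g * nfix (m + gaplen h) B"
    using nfix_gapset_left[OF B, of g "m + gaplen h"] by (simp add: n_eq)
  also have "nfix (m + gaplen h) B = fine_num m * gapprod h"
    using nfix_gapset_right[of "{}" m h] by (simp add: B_def)
  finally show ?thesis by (simp add: m_def)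
qed

section \<open>Fixed points seen from the two ends\<close>

definition left_fix :: "nat \<Rightarrow> (nat \<Rightarrow> nat) \<Rightarrow> nat set" where
  "left_fix n \<tau> = fixset n \<tau> \<inter> {..n div 2}"

definition right_fix :: "nat \<Rightarrow> (nat \<Rightarrow> nat) \<Rightarrow> nat set" where
  "right_fix n \<tau> = (\<lambda>i. n + 1 - i) ` (fixset n \<tau> \<inter> {n div 2<..})"

text \<open>The bound on \<open>n\<close> puts each gap set on its own half, so cutting the set of
  fixed points at \<open>n div 2\<close> recovers both.\<close>

lemma left_right_fix_eq_iff:
  assumes n: "2 * (gaplen g + gaplen h) \<le> n"
  shows "left_fix n \<tau> = gapset g \<and> right_fix n \<tau> = gapset h
     \<longleftrightarrow> fixset n \<tau> = gapset g \<union> (\<lambda>x. n + 1 - x) ` gapset h" (is "?l \<longleftrightarrow> ?r")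
proof -
  define r where "r x = n + 1 - x" for x
  have g: "x \<le> n div 2" if "x \<in> gapset g" for x
  proof -
    have "x \<le> gaplen g" using gapset_bounds[of g] that by auto
    thus ?thesis using n by (simp add: less_eq_div_iff_mult_less_eq)
  qed
  have h: "1 \<le> x \<and> x \<le> n div 2" if "x \<in> gapset h" for x
  proof -
    have "1 \<le> x" "x \<le> gaplen h" using gapset_bounds[of h] that by auto
    thus ?thesis using n by (simp add: less_eq_div_iff_mult_less_eq)
  qed
  have rh: "n div 2 < r x" if "x \<in> gapset h" for x
    using h[OF that] by (auto simp: r_def)
  \<comment> \<open>The bound matters because truncated subtraction makes the reflection an
    involution only up to \<open>n + 1\<close>.\<close>
  have rr: "r (r x) = x" if "x \<le> n + 1" for x
    using that by (simp add: r_def)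
  have F: "fixset n \<tau> \<subseteq> {1..n}" by (auto simp: fixset_def)
  have right: "right_fix n \<tau> = r ` (fixset n \<tau> \<inter> {n div 2<..})"
    by (simp add: right_fix_def r_def)
  have "?l \<longleftrightarrow> fixset n \<tau> = gapset g \<union> r ` gapset h"
  proof
    assume l: ?l
    have "r ` gapset h = (\<lambda>x. r (r x)) ` (fixset n \<tau> \<inter> {n div 2<..})"
      using l by (simp add: right image_image[symmetric])
    also have "\<dots> = (\<lambda>x. x) ` (fixset n \<tau> \<inter> {n div 2<..})"
      by (rule image_cong[OF refl], rule rr) (use F in auto)
    finally have "r ` gapset h = fixset n \<tau> \<inter> {n div 2<..}" by simp
    moreover have "gapset g = fixset n \<tau> \<inter> {..n div 2}"
      using l by (simp add: left_fix_def)
    ultimately show "fixset n \<tau> = gapset g \<union> r ` gapset h"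
      by auto
  next
    assume R: "fixset n \<tau> = gapset g \<union> r ` gapset h"
    have "fixset n \<tau> \<inter> {..n div 2} = gapset g"
      unfolding R using g rh by force
    moreover have "fixset n \<tau> \<inter> {n div 2<..} = r ` gapset h"
      unfolding R using g rh by force
    moreover have "r ` r ` gapset h = (\<lambda>x. x) ` gapset h"
      unfolding image_image by (rule image_cong[OF refl], rule rr) (use h in force)
    ultimately show ?l by (simp add: left_fix_def right)
  qed
  thus ?thesis by (simp add: r_def)
qed

lemma card_left_right_fix:
  assumes n: "2 * (gaplen g + gaplen h) \<le> n"
  shows "card {\<tau> \<in> Av321 n. left_fix n \<tau> = gapset g \<and> right_fix n \<tau> = gapset h}
       = gapprod g * gapprod h * fine_num (n - (gaplen g + gaplen h))"
  using nfix_gapsets[of g h n] n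
  by (simp add: left_right_fix_eq_iff[OF n] nfix_def del: One_nat_def)

section \<open>Weighted lists of tree sizes\<close>

text \<open>The partial sums reached at trees of size one, that is, the atoms of a limit
  measure.\<close>

fun ones_pos :: "nat list \<Rightarrow> nat set" where
  "ones_pos [] = {}"
| "ones_pos (s # a) = (if s = 1 then {1} else {}) \<union> (+) s ` ones_pos a"

text \<open>Half the probability that a Galton-Watson tree has \<open>s\<close> vertices; the factor 1/2 is the
  probability that the geometric number of trees has not been exhausted.\<close>
definition step_weight :: "nat \<Rightarrow> real" where
  "step_weight s = (if s = 0 then 0 else real (cat (s - 1)) / 4 ^ s)"

text \<open>Twice the probability that a Geometric(1/2) number of trees has this list of sizes: the
  stopping factor 1/2 is left out, so that the empty list weighs 1.\<close>

definition weight :: "nat list \<Rightarrow> real" where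
  "weight a = prod_list (map step_weight a)"

lemma weight_simps [simp]: "weight [] = 1" "weight (s # a) = step_weight s * weight a"
  by (simp_all add: weight_def)

lemma zero_notin_ones_pos: "0 \<notin> ones_pos a"
  by (induction a) auto

text \<open>A leading 1 opens a gap of length 0; any other leading size is absorbed into the first
  gap, or disappears if no point follows. So gap lists cover all limit configurations.\<close>

lemma ones_pos_eq_gapset: "\<exists>g. ones_pos a = gapset g"
proof (induction a)
  case Nil
  show ?case by (rule exI[of _ "[]"]) simp
next
  case (Cons s a)
  then obtain g where g: "ones_pos a = gapset g" by blast
  show ?case
  proof (cases "s = 1")
    case True
    have "ones_pos (s # a) = gapset (0 # g)" using True g by simp
    thus ?thesis by blast
  next
    case False
    show ?thesis
    proof (cases g)
      case Nil
      have "ones_pos (s # a) = gapset []" using False g Nil by simp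
      thus ?thesis by blast
    next
      case (Cons k g')
      have "ones_pos (s # a) = gapset ((s + k) # g')"
        using False g Cons by (simp add: image_image add.assoc)
      thus ?thesis by blast
    qed
  qed
qed

text \<open>Splitting by the first entry turns each recursive description of a set of lists into an
  equation between total weights.\<close>

lemma infsum_weight_rec:
  assumes "weight summable_on UNIV"
  shows "infsum weight E = of_bool ([] \<in> E) + (\<Sum>\<^sub>\<infinity>s. step_weight s * infsum weight {a. s # a \<in> E})"
proof -
  have sub: "weight summable_on A" for A
    using summable_on_subset_banach[OF assms] by blast
  define S where "S = (SIGMA s:UNIV. {a. s # a \<in> E})"
  define c where "c = (\<lambda>(s, a). s # a :: nat list)"
  have inj: "inj_on c S" by (auto simp: inj_on_def c_def)
  have "E = (E \<inter> {[]}) \<union> c ` S"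
  proof (rule set_eqI)
    fix a show "a \<in> E \<longleftrightarrow> a \<in> (E \<inter> {[]}) \<union> c ` S"
      by (cases a) (auto simp: S_def c_def image_iff)
  qed
  moreover have "(E \<inter> {[]}) \<inter> c ` S = {}" by (auto simp: c_def)
  ultimately have "infsum weight E = infsum weight (E \<inter> {[]}) + infsum weight (c ` S)"
    using infsum_Un_disjoint[OF sub sub] by metis
  also have "infsum weight (E \<inter> {[]}) = of_bool ([] \<in> E)"
    by (cases "[] \<in> E") auto
  also have "infsum weight (c ` S) = infsum (weight \<circ> c) S"
    by (rule infsum_reindex[OF inj])
  also have "\<dots> = (\<Sum>\<^sub>\<infinity>s. infsum (\<lambda>a. (weight \<circ> c) (s, a)) {a. s # a \<in> E})"
    unfolding S_def
    by (rule infsum_Sigma_banach[symmetric])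
       (use summable_on_reindex[OF inj, of weight] sub in \<open>simp add: S_def\<close>)
  also have "\<dots> = (\<Sum>\<^sub>\<infinity>s. step_weight s * infsum weight {a. s # a \<in> E})"
    by (simp add: c_def infsum_cmult_right')
  finally show ?thesis .
qed

text \<open>A first entry 1 places a point at 1, which forces \<open>k = 0\<close>; a larger
  \<open>s\<close> pushes all points beyond \<open>s\<close>, so it must fit into the first gap,
  which it shortens.\<close>

lemma ones_pos_Cons_eq_gapset_Cons:
  assumes "0 < s"
  shows "{a. ones_pos (s # a) = gapset (k # g)} =
     (if s = 1 \<and> k = 0 then {a. ones_pos a = gapset g}
      else if 2 \<le> s \<and> s \<le> k then {a. ones_pos a = gapset ((k - s) # g)} else {})"
proof -
  have inj: "(+) m ` A = (+) m ` B \<longleftrightarrow> A = B" for m :: nat and A B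
    by (rule inj_image_eq_iff) simp
  show ?thesis
  proof (cases "s = 1")
    case s: True
    show ?thesis
    proof (cases "k = 0")
      case True
      have "ones_pos (s # a) = gapset (k # g) \<longleftrightarrow> ones_pos a = gapset g" for a
      proof -
        have "ones_pos (s # a) = gapset (k # g) \<longleftrightarrow>
          insert 1 ((+) 1 ` ones_pos a) = insert 1 ((+) 1 ` gapset g)"
          by (simp add: s True)
        also have "\<dots> \<longleftrightarrow> (+) 1 ` ones_pos a = (+) 1 ` gapset g"
          by (rule insert_ident) (use zero_notin_ones_pos[of a] zero_notin_gapset[of g] in auto)
        finally show ?thesis by (simp only: inj)
      qed
      thus ?thesis using s True by simp
    next
      case False
      hence "1 \<notin> gapset (k # g)" by auto
      moreover have "1 \<in> ones_pos (s # a)" for a by (simp add: s)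
      ultimately have "{a. ones_pos (s # a) = gapset (k # g)} = {}" by blast
      thus ?thesis using s False by simp
    qed
  next
    case s: False
    show ?thesis
    proof (cases "s \<le> k")
      case True
      hence "gapset (k # g) = (+) s ` gapset ((k - s) # g)"
        by (simp add: image_image)
      thus ?thesis using s True assms by (simp add: inj del: gapset.simps)
    next
      case False
      have "Suc k \<notin> ones_pos (s # a)" for a
        using s False zero_notin_ones_pos[of a] by (auto simp: image_iff) (metis Suc_lessI add_eq_self_zero add_leD1 le_antisym less_eq_Suc_le linorder_not_le)
      moreover have "Suc k \<in> gapset (k # g)" by simp
      ultimately have "{a. ones_pos (s # a) = gapset (k # g)} = {}" by blast
      thus ?thesis using s False by simp
    qed
  qed
qed

text \<open>These facts are supplied later by probability: each of them is read off from the law of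
  a discrete random variable.\<close>

context
  assumes weight_summable: "weight summable_on UNIV"
    and step_weight_summable: "step_weight summable_on UNIV"
    and step_weight_total: "infsum step_weight UNIV = 1 / 2"
begin

text \<open>First-entry analysis gives x = 1 + (1/2 - 1/4) x, where 1/4 is the weight of the
  excluded size 1.\<close>

lemma infsum_weight_no_ones: "infsum weight {a. ones_pos a = {}} = 4 / 3"
proof -
  define x where "x = infsum weight {a. ones_pos a = {}}"
  have "x = 1 + (\<Sum>\<^sub>\<infinity>s. step_weight s * infsum weight {a. ones_pos (s # a) = {}})"
    unfolding x_def by (subst infsum_weight_rec[OF weight_summable]) simp
  also have "(\<Sum>\<^sub>\<infinity>s. step_weight s * infsum weight {a. ones_pos (s # a) = {}})
      = (\<Sum>\<^sub>\<infinity>s\<in>UNIV - {1}. step_weight s * x)"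
    by (rule infsum_cong_neutral) (auto simp: x_def)
  also have "\<dots> = infsum step_weight (UNIV - {1}) * x"
    by (rule infsum_cmult_left')
  also have "infsum step_weight (UNIV - {1}) = 1 / 2 - step_weight 1"
    using infsum_Diff[OF step_weight_summable, of "{1}"] step_weight_total by simp
  finally show ?thesis
    by (simp add: x_def[symmetric] step_weight_def)
qed

text \<open>A first tree of size \<open>s \<ge> 2\<close> leaves the gap \<open>k - s\<close>, and a
  singleton closes the gap 0. The resulting recursion is \<open>fine_rec\<close> divided by
  \<open>4 ^ Suc k\<close>.\<close>

lemma infsum_weight_gapset_Cons:
  "infsum weight {a. ones_pos a = gapset (k # g)}
     = real (fine_num k) / 4 ^ Suc k * infsum weight {a. ones_pos a = gapset g}"
proof (induction k rule: less_induct)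
  case (less k)
  define y where "y = infsum weight {a. ones_pos a = gapset g}"
  have "infsum weight {a. ones_pos a = gapset (k # g)}
      = (\<Sum>\<^sub>\<infinity>s. step_weight s * infsum weight {a. ones_pos (s # a) = gapset (k # g)})"
    by (subst infsum_weight_rec[OF weight_summable]) simp
  also have "\<dots> = (\<Sum>\<^sub>\<infinity>s\<in>insert 1 {2..k}.
      step_weight s * infsum weight {a. ones_pos (s # a) = gapset (k # g)})"
  proof (rule infsum_cong_neutral)
    fix s assume "s \<in> UNIV - insert 1 {2..k}"
    thus "step_weight s * infsum weight {a. ones_pos (s # a) = gapset (k # g)} = 0"
      by (cases "s = 0") (auto simp: step_weight_def ones_pos_Cons_eq_gapset_Cons simp del: ones_pos.simps gapset.simps)
  qed auto
  also have "\<dots> = (\<Sum>s\<in>insert 1 {2..k}.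
      step_weight s * infsum weight {a. ones_pos (s # a) = gapset (k # g)})"
    by (rule infsum_finite) simp
  also have "\<dots> = of_bool (k = 0) * y / 4
      + (\<Sum>s=2..k. step_weight s * infsum weight {a. ones_pos a = gapset ((k - s) # g)})"
    by (subst sum.insert)
       (auto simp: ones_pos_Cons_eq_gapset_Cons step_weight_def y_def simp del: ones_pos.simps gapset.simps intro!: sum.cong)
  also have "(\<Sum>s=2..k. step_weight s * infsum weight {a. ones_pos a = gapset ((k - s) # g)})
      = (\<Sum>s=2..k. real (cat (s - 1)) * real (fine_num (k - s)) / 4 ^ Suc k * y)"
  proof (rule sum.cong[OF refl])
    fix s assume s: "s \<in> {2..k}"
    have "infsum weight {a. ones_pos a = gapset ((k - s) # g)} = real (fine_num (k - s)) / 4 ^ Suc (k - s) * y"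
      unfolding y_def using s by (intro less) auto
    moreover have "(4 :: real) ^ Suc k = 4 ^ s * 4 ^ Suc (k - s)"
      using s by (simp flip: power_add)
    ultimately show "step_weight s * infsum weight {a. ones_pos a = gapset ((k - s) # g)}
        = real (cat (s - 1)) * real (fine_num (k - s)) / 4 ^ Suc k * y"
      using s by (simp add: step_weight_def)
  qed
  also have "of_bool (k = 0) * y / 4 + \<dots>
      = (of_bool (k = 0) + (\<Sum>s=2..k. real (cat (s - 1)) * real (fine_num (k - s)))) / 4 ^ Suc k * y"
    by (cases "k = 0") (simp_all add: sum_distrib_right sum_divide_distrib)
  also have "\<dots> = real (fine_num k) / 4 ^ Suc k * y"
    by (subst fine_rec[of k]) (rule refl)
  finally show ?case by (simp only: y_def)
qed

text \<open>Each gap contributes its Fine number, and 4/3 accounts for the trees behind the last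
  singleton.\<close>

lemma infsum_weight_gapset:
  "infsum weight {a. ones_pos a = gapset g} = 4 / 3 * real (gapprod g) / 4 ^ gaplen g"
proof (induction g)
  case Nil
  show ?case using infsum_weight_no_ones by simp
next
  case (Cons k g)
  show ?case
    unfolding infsum_weight_gapset_Cons Cons by (simp add: power_add mult_ac)
qed

end

section \<open>Convergence of expectations from convergence of mass functions\<close>

lemma measure_pmf_infsum: "measure (measure_pmf p) A = infsum (pmf p) A"
  unfolding measure_pmf_conv_infsetsum by (rule infsetsum_infsum) (rule pmf_abs_summable)

lemma pmf_summable_on: "pmf p summable_on A"
proof -
  have "(\<lambda>x. norm (pmf p x)) summable_on A"
    using pmf_abs_summable abs_summable_equivalent by blast
  thus ?thesis by simp
qed

lemma expectation_pmf_approx: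
  fixes f :: "'x \<Rightarrow> real"
  assumes B: "\<And>x. \<bar>f x\<bar> \<le> B" and K: "finite K"
  shows "\<bar>measure_pmf.expectation p f - (\<Sum>x\<in>K. pmf p x * f x)\<bar> \<le> B * (1 - (\<Sum>x\<in>K. pmf p x))"
proof -
  have int: "integrable (measure_pmf p) g" if "\<And>x. \<bar>g x\<bar> \<le> C" for g :: "'x \<Rightarrow> real" and C
    by (rule measure_pmf.integrable_const_bound[where B = C]) (use that in auto)
  have B0: "0 \<le> B" using B[of undefined] by linarith
  have "measure_pmf.expectation p (\<lambda>x. f x * indicator K x) = (\<Sum>x\<in>K. pmf p x * f x)"
    by (subst integral_measure_pmf[OF K]) (auto simp: indicator_def mult.commute intro!: sum.cong)
  moreover have "measure_pmf.expectation p f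
      = measure_pmf.expectation p (\<lambda>x. f x * indicator K x) + measure_pmf.expectation p (\<lambda>x. f x * indicator (- K) x)"
    by (subst Bochner_Integration.integral_add[symmetric])
       (use B B0 in \<open>auto intro!: int[where C = B] Bochner_Integration.integral_cong simp: indicator_def\<close>)
  moreover have "\<bar>measure_pmf.expectation p (\<lambda>x. f x * indicator (- K) x)\<bar>
      \<le> measure_pmf.expectation p (\<lambda>x. B * indicator (- K) x)"
  proof -
    have "\<bar>measure_pmf.expectation p (\<lambda>x. f x * indicator (- K) x)\<bar>
        \<le> measure_pmf.expectation p (\<lambda>x. \<bar>f x * indicator (- K) x\<bar>)"
      by (rule integral_abs_bound)
    also have "\<dots> \<le> measure_pmf.expectation p (\<lambda>x. B * indicator (- K) x)"
    proof (rule integral_mono)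
      show "integrable (measure_pmf p) (\<lambda>x. \<bar>f x * indicator (- K) x\<bar>)"
        by (rule int[where C = B]) (use B B0 in \<open>auto simp: indicator_def\<close>)
      show "integrable (measure_pmf p) (\<lambda>x. B * indicator (- K) x)"
        by (rule int[where C = B]) (use B B0 in \<open>auto simp: indicator_def\<close>)
    qed (use B in \<open>auto simp: indicator_def\<close>)
    finally show ?thesis .
  qed
  moreover have "measure_pmf.expectation p (\<lambda>x. B * indicator (- K) x) = B * (1 - (\<Sum>x\<in>K. pmf p x))"
    using measure_pmf.prob_compl[of K p] measure_measure_pmf_finite[OF K, of p]
    by (simp add: Compl_eq_Diff_UNIV)
  ultimately show ?thesis by linarith
qed

text \<open>Tightness is automatic: a finite \<open>K\<close> carrying nearly all of
  \<open>q\<close> eventually carries nearly all of \<open>p n\<close>, since the finite sums over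
  \<open>K\<close> converge.\<close>

lemma expectation_tendsto_pmf:
  fixes p :: "nat \<Rightarrow> 'x pmf" and f :: "'x \<Rightarrow> real"
  assumes lim: "\<And>x. x \<in> set_pmf q \<Longrightarrow> (\<lambda>n. pmf (p n) x) \<longlonglongrightarrow> pmf q x"
    and B: "\<And>x. \<bar>f x\<bar> \<le> B"
  shows "(\<lambda>n. measure_pmf.expectation (p n) f) \<longlonglongrightarrow> measure_pmf.expectation q f"
proof (rule LIMSEQ_I)
  fix r :: real assume r: "0 < r"
  have B0: "0 \<le> B" using B[of undefined] by linarith
  \<comment> \<open>The two tails cost at most r/4 each and the sums over \<open>K\<close> differ by
    less than r/2; the summand 1 covers \<open>B = 0\<close>.\<close>
  define \<epsilon> where "\<epsilon> = r / (4 * (B + 1))"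
  have \<epsilon>: "0 < \<epsilon>" using r B0 by (simp add: \<epsilon>_def)
  have B\<epsilon>: "B * \<epsilon> \<le> r / 4"
    using r B0 by (simp add: \<epsilon>_def field_simps)
  have "measure (measure_pmf q) (set_pmf q) = 1"
    by (subst measure_pmf.prob_eq_1) (auto simp: AE_measure_pmf)
  hence "infsum (pmf q) (set_pmf q) = 1"
    by (simp only: measure_pmf_infsum)
  hence "(pmf q has_sum 1) (set_pmf q)"
    using has_sum_infsum[OF pmf_summable_on] by metis
  hence "\<forall>\<^sub>F K in finite_subsets_at_top (set_pmf q). 1 - \<epsilon> < sum (pmf q) K"
    unfolding has_sum_def by (rule order_tendstoD(1)) (use \<epsilon> in simp)
  then obtain K where K: "finite K" "K \<subseteq> set_pmf q" "1 - \<epsilon> < sum (pmf q) K"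
    unfolding eventually_finite_subsets_at_top by blast
  have "(\<lambda>n. sum (pmf (p n)) K) \<longlonglongrightarrow> sum (pmf q) K"
    by (intro tendsto_sum lim) (use K in auto)
  hence ev1: "\<forall>\<^sub>F n in sequentially. 1 - \<epsilon> < sum (pmf (p n)) K"
    by (rule order_tendstoD(1)) (rule K)
  have "(\<lambda>n. \<Sum>x\<in>K. pmf (p n) x * f x) \<longlonglongrightarrow> (\<Sum>x\<in>K. pmf q x * f x)"
    by (intro tendsto_sum tendsto_mult tendsto_const lim) (use K in auto)
  hence ev2: "\<forall>\<^sub>F n in sequentially. \<bar>(\<Sum>x\<in>K. pmf (p n) x * f x) - (\<Sum>x\<in>K. pmf q x * f x)\<bar> < r / 2"
    using r by (auto dest!: tendstoD[where e = "r / 2"] simp: dist_real_def)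
  have "\<forall>\<^sub>F n in sequentially. norm (measure_pmf.expectation (p n) f - measure_pmf.expectation q f) < r"
    using ev1 ev2
  proof eventually_elim
    case (elim n)
    have "B * (1 - sum (pmf (p n)) K) \<le> B * \<epsilon>" "B * (1 - sum (pmf q) K) \<le> B * \<epsilon>"
      using elim K(3) B0 by (auto intro!: mult_left_mono)
    thus ?case
      using expectation_pmf_approx[of f, OF B K(1), of "p n"]
        expectation_pmf_approx[of f, OF B K(1), of q] elim B\<epsilon>
      by (simp only: real_norm_def abs_le_iff abs_less_iff) linarith
  qed
  thus "\<exists>no. \<forall>n\<ge>no. norm (measure_pmf.expectation (p n) f - measure_pmf.expectation q f) < r"
    by (simp add: eventually_sequentially)
qed

text \<open>On a countable type almost every point is an atom, so the law is a
  \<open>pmf\<close>.\<close>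

lemma (in prob_space) obtain_law_pmf:
  fixes Z :: "'a \<Rightarrow> 'x :: countable"
  assumes Z: "Z \<in> M \<rightarrow>\<^sub>M count_space UNIV"
  obtains q where "measure_pmf q = distr M (count_space UNIV) Z"
    "\<And>x. pmf q x = prob {\<omega> \<in> space M. Z \<omega> = x}"
proof -
  define D where "D = distr M (count_space UNIV) Z"
  interpret D: prob_space D unfolding D_def by (rule prob_space_distr[OF Z])
  have sets_D: "sets D = UNIV" by (simp add: D_def)
  have "AE x in D. measure D {x} \<noteq> 0"
    by (subst D.AE_support_countable) (auto intro!: exI[of _ UNIV] simp: D_def)
  hence D: "measure_pmf (Abs_pmf D) = D"
    using D.prob_space_axioms by (intro Abs_pmf_inverse) (simp add: sets_D)
  show ?thesis
  proof (rule that[of "Abs_pmf D"])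
    show "measure_pmf (Abs_pmf D) = distr M (count_space UNIV) Z" unfolding D by (rule D_def)
    fix x
    have "pmf (Abs_pmf D) x = measure D {x}" by (simp add: pmf.rep_eq D)
    also have "\<dots> = prob (Z -` {x} \<inter> space M)"
      unfolding D_def by (rule measure_distr[OF Z]) simp
    also have "Z -` {x} \<inter> space M = {\<omega> \<in> space M. Z \<omega> = x}" by auto
    finally show "pmf (Abs_pmf D) x = prob {\<omega> \<in> space M. Z \<omega> = x}" .
  qed
qed

section \<open>The random measures as indicator functions\<close>

text \<open>Injectivity excludes repeated atoms, so sets can stand for the random measures.\<close>

lemma sum_dirac_eq_indicator:
  assumes "finite I" "inj_on f I"
  shows "(\<lambda>k. \<Sum>i\<in>I. dirac (f i) k * (if P i then 1 else 0)) = indicator (f ` {i \<in> I. P i})"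
proof
  fix k
  show "(\<Sum>i\<in>I. dirac (f i) k * (if P i then 1 else 0)) = indicator (f ` {i \<in> I. P i}) k"
  proof (cases "k \<in> f ` {i \<in> I. P i}")
    case True
    then obtain i where i: "i \<in> I" "P i" "k = f i" by blast
    have "(\<Sum>i\<in>I. dirac (f i) k * (if P i then 1 else 0)) = (\<Sum>j\<in>I. if j = i then 1 else 0)"
      by (rule sum.cong) (use i assms(2) in \<open>auto simp: dirac_def inj_on_def\<close>)
    thus ?thesis using True i assms(1) by simp
  next
    case False
    thus ?thesis by (auto simp: dirac_def intro!: sum.neutral)
  qed
qed

lemma fixed_measures_eq: "fixed_measures n \<tau> = (indicator (left_fix n \<tau>), indicator (right_fix n \<tau>))"
proof -
  have "(\<lambda>k. \<Sum>i\<in>{1..n div 2}. dirac i k * (if \<tau> i = i then 1 else 0))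
      = indicator ((\<lambda>i. i) ` {i \<in> {1..n div 2}. \<tau> i = i})"
    by (rule sum_dirac_eq_indicator) auto
  moreover have "(\<lambda>i. i) ` {i \<in> {1..n div 2}. \<tau> i = i} = left_fix n \<tau>"
    by (auto simp: left_fix_def fixset_def)
  moreover have "(\<lambda>k. \<Sum>i\<in>{n div 2 + 1..n}. dirac (n + 1 - i) k * (if \<tau> i = i then 1 else 0))
      = indicator ((\<lambda>i. n + 1 - i) ` {i \<in> {n div 2 + 1..n}. \<tau> i = i})"
    by (rule sum_dirac_eq_indicator) (auto simp: inj_on_def)
  moreover have "{i \<in> {n div 2 + 1..n}. \<tau> i = i} = fixset n \<tau> \<inter> {n div 2<..}"
    by (auto simp: fixset_def)
  ultimately show ?thesis by (simp add: fixed_measures_def right_fix_def)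
qed

lemma ones_pos_map_upt:
  "ones_pos (map f [0..<l]) = (\<lambda>i. \<Sum>j\<le>i. f j) ` {i. i < l \<and> f i = 1}"
proof (induction l arbitrary: f)
  case (Suc l)
  have set: "{i. i < Suc l \<and> f i = 1} = (if f 0 = 1 then {0} else {}) \<union> Suc ` {i. i < l \<and> f (Suc i) = 1}"
    (is "?A = ?B")
  proof (rule set_eqI)
    fix i show "i \<in> ?A \<longleftrightarrow> i \<in> ?B" by (cases i) auto
  qed
  have "map f [0..<Suc l] = f 0 # map (\<lambda>i. f (Suc i)) [0..<l]"
    by (simp only: upt_conv_Cons map_Suc_upt[symmetric] list.map map_map o_def zero_less_Suc)
  hence "ones_pos (map f [0..<Suc l])
      = (if f 0 = 1 then {1} else {}) \<union> (+) (f 0) ` ((\<lambda>i. \<Sum>j\<le>i. f (Suc j)) ` {i. i < l \<and> f (Suc i) = 1})"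
    by (simp only: ones_pos.simps Suc)
  also have "\<dots> = (\<lambda>i. \<Sum>j\<le>i. f j) ` {i. i < Suc l \<and> f i = 1}"
    unfolding set by (auto simp: image_Un image_image sum.atMost_Suc_shift simp del: sum.atMost_Suc)
  finally show ?case .
qed simp

definition left_sizes :: "nat \<Rightarrow> (nat \<Rightarrow> ptree) \<Rightarrow> nat list" where
  "left_sizes N T = map (\<lambda>i. tsize (T (Suc i))) [0..<N - 1]"

text \<open>Listed from the right end.\<close>
definition right_sizes :: "nat \<Rightarrow> nat \<Rightarrow> (nat \<Rightarrow> ptree) \<Rightarrow> nat list" where
  "right_sizes X N T = map (\<lambda>i. tsize (T (X - i))) [0..<X - N]"

text \<open>Trees are nonempty, so partial sums are strictly monotone and the atoms distinct. The
  right-hand sums, taken from \<open>X\<close> downwards, are partial sums of the reversed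
  list.\<close>

lemma limit_measures_eq:
  "limit_measures X N T = (indicator (ones_pos (left_sizes N T)), indicator (ones_pos (right_sizes X N T)))"
proof -
  define S where "S j = tsize (T j)" for j
  have pos: "0 < S j" for j by (simp add: S_def tsize_pos)
  have fst_eq: "(\<lambda>k. \<Sum>i\<in>{1..N - 1}. dirac (\<Sum>j\<in>{1..i}. S j) k * (if S i = 1 then 1 else 0))
      = indicator ((\<lambda>i. \<Sum>j\<in>{1..i}. S j) ` {i \<in> {1..N - 1}. S i = 1})"
  proof (rule sum_dirac_eq_indicator)
    have "strict_mono (\<lambda>i. \<Sum>j\<in>{1..i}. S j)"
      by (rule strict_monoI_Suc) (simp add: pos)
    thus "inj_on (\<lambda>i. \<Sum>j\<in>{1..i}. S j) {1..N - 1}"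
      by (meson inj_on_subset strict_mono_imp_inj_on subset_UNIV)
  qed simp
  have sum1: "(\<Sum>j\<in>{1..Suc i}. S j) = (\<Sum>j\<le>i. S (Suc j))" for i
    by (rule sum.reindex_bij_witness[of _ Suc "\<lambda>j. j - 1"]) auto
  have "{i \<in> {1..N - 1}. S i = 1} = Suc ` {i. i < N - 1 \<and> S (Suc i) = 1}"
  proof (intro equalityI subsetI)
    fix i assume "i \<in> {i \<in> {1..N - 1}. S i = 1}"
    thus "i \<in> Suc ` {i. i < N - 1 \<and> S (Suc i) = 1}"
      by (intro image_eqI[of _ _ "i - 1"]) auto
  qed auto
  hence "(\<lambda>i. \<Sum>j\<in>{1..i}. S j) ` {i \<in> {1..N - 1}. S i = 1} = ones_pos (left_sizes N T)"
    by (simp add: left_sizes_def ones_pos_map_upt image_image sum1 S_def[symmetric]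
        del: sum.cl_ivl_Suc One_nat_def)
  note left = fst_eq[unfolded this]
  have snd_eq: "(\<lambda>k. \<Sum>i\<in>{N + 1..X}. dirac (\<Sum>j\<in>{i..X}. S j) k * (if S i = 1 then 1 else 0))
      = indicator ((\<lambda>i. \<Sum>j\<in>{i..X}. S j) ` {i \<in> {N + 1..X}. S i = 1})"
  proof (rule sum_dirac_eq_indicator)
    have "(\<Sum>j\<in>{y..X}. S j) < (\<Sum>j\<in>{x..X}. S j)" if "x < y" "x \<le> X" for x y
      by (rule sum_strict_mono2[of _ _ x]) (use that pos[of x] in auto)
    thus "inj_on (\<lambda>i. \<Sum>j\<in>{i..X}. S j) {N + 1..X}"
      by (intro linorder_inj_onI) (force dest: less_imp_neq)+
  qed simp
  have sum2: "(\<Sum>j\<in>{X - i..X}. S j) = (\<Sum>j\<le>i. S (X - j))" if "i < X - N" for i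
    by (rule sum.reindex_bij_witness[of _ "\<lambda>j. X - j" "\<lambda>j. X - j"]) (use that in auto)
  have "{i \<in> {N + 1..X}. S i = 1} = (\<lambda>i. X - i) ` {i. i < X - N \<and> S (X - i) = 1}"
  proof (intro equalityI subsetI)
    fix i assume "i \<in> {i \<in> {N + 1..X}. S i = 1}"
    thus "i \<in> (\<lambda>i. X - i) ` {i. i < X - N \<and> S (X - i) = 1}"
      by (intro image_eqI[of _ _ "X - i"]) auto
  qed auto
  hence "(\<lambda>i. \<Sum>j\<in>{i..X}. S j) ` {i \<in> {N + 1..X}. S i = 1} = ones_pos (right_sizes X N T)"
    by (simp add: right_sizes_def ones_pos_map_upt image_image S_def[symmetric] sum2 cong: image_cong_simp)
  note right = snd_eq[unfolded this]
  show ?thesis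
    using left right by (simp add: limit_measures_def S_def)
qed

lemma indicator_in_MF:
  assumes "finite A" "0 \<notin> A"
  shows "indicator A \<in> MF"
proof -
  have "summable (indicator A :: nat \<Rightarrow> real)"
    by (rule summable_finite[OF assms(1)]) (simp add: indicator_def)
  thus ?thesis using assms(2) by (simp add: MF_def)
qed

text \<open>The zero function and the open set \<open>UNIV\<close> make \<open>MF\<close> itself a
  generator.\<close>

lemma MF_subset_topspace: "MF \<subseteq> topspace MF_topology"
proof -
  have "{m \<in> MF. integ (\<lambda>_. 0) m \<in> UNIV} \<in> {{m \<in> MF. integ f m \<in> U} | f U. bounded (range f) \<and> open U}"
    by (intro CollectI exI[of _ "\<lambda>_. 0"] exI[of _ UNIV]) auto
  thus ?thesis
    unfolding MF_topology_def topology_generated_by_topspace by blast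
qed

section \<open>The limit law\<close>

lemma measurable_map_count_space:
  assumes "\<And>i. i \<in> set is \<Longrightarrow> f i \<in> M \<rightarrow>\<^sub>M count_space UNIV"
  shows "(\<lambda>\<omega>. map (\<lambda>i. f i \<omega> :: 'x :: countable) is) \<in> M \<rightarrow>\<^sub>M count_space UNIV"
  using assms
proof (induction "is")
  case (Cons i "is")
  have "(\<lambda>\<omega>. s # map (\<lambda>i. f i \<omega>) is) \<in> M \<rightarrow>\<^sub>M count_space UNIV" for s
    by (rule measurable_compose[OF Cons.IH]) (use Cons.prems in auto)
  hence "(\<lambda>\<omega>. f i \<omega> # map (\<lambda>i. f i \<omega>) is) \<in> M \<rightarrow>\<^sub>M count_space UNIV"
    by (rule measurable_compose_countable) (use Cons.prems in auto)
  thus ?case by simp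
qed simp

text \<open>\<open>X\<close> and \<open>N\<close> are dependent and therefore share the index
  \<open>None\<close>; the sum type lets the pair and the trees form one independent family.\<close>

locale gw_forest = prob_space M for M :: "'a measure" +
  fixes T :: "nat \<Rightarrow> 'a \<Rightarrow> ptree" and X N :: "'a \<Rightarrow> nat"
  assumes T_measurable: "\<And>j. j \<ge> 1 \<Longrightarrow> T j \<in> M \<rightarrow>\<^sub>M count_space UNIV"
    and X_measurable: "X \<in> M \<rightarrow>\<^sub>M count_space UNIV"
    and N_measurable: "N \<in> M \<rightarrow>\<^sub>M count_space UNIV"
    and indep: "indep_vars (\<lambda>_. count_space UNIV)
           (\<lambda>i. case i of None \<Rightarrow> (\<lambda>\<omega>. Inl (X \<omega>, N \<omega>)) | Some j \<Rightarrow> (\<lambda>\<omega>. Inr (T j \<omega>)))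
           (insert None (Some ` {1..}))"
    and T_law: "\<And>j t. j \<ge> 1 \<Longrightarrow> prob {\<omega> \<in> space M. T j \<omega> = t} = gw_prob t"
    and XN_law: "\<And>k m. prob {\<omega> \<in> space M. X \<omega> = k \<and> N \<omega> = m} =
           (if 1 \<le> k \<and> 1 \<le> m \<and> m \<le> k then (real k * (1/2) ^ (k + 1)) * (1 / real k) else 0)"
begin

lemma size_measurable: "j \<ge> 1 \<Longrightarrow> (\<lambda>\<omega>. tsize (T j \<omega>)) \<in> M \<rightarrow>\<^sub>M count_space UNIV"
  by (rule measurable_compose[OF T_measurable]) auto

text \<open>All trees of one size are equally likely, so only their number matters.\<close>

lemma size_law:
  assumes "j \<ge> 1"
  shows "prob {\<omega> \<in> space M. tsize (T j \<omega>) = s} = 2 * step_weight s"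
proof -
  have ev: "{\<omega> \<in> space M. T j \<omega> = t} \<in> events" for t
  proof -
    have "T j -` {t} \<inter> space M \<in> events"
      by (rule measurable_sets[OF T_measurable[OF assms]]) simp
    thus ?thesis by (simp add: vimage_def Int_def conj_commute)
  qed
  have "{\<omega> \<in> space M. tsize (T j \<omega>) = s} = (\<Union>t\<in>trees s. {\<omega> \<in> space M. T j \<omega> = t})"
    by (auto simp: trees_def)
  also have "prob \<dots> = (\<Sum>t\<in>trees s. prob {\<omega> \<in> space M. T j \<omega> = t})"
    by (rule finite_measure_finite_Union) (use ev in \<open>auto simp: finite_trees disjoint_family_on_def\<close>)
  also have "\<dots> = (\<Sum>t\<in>trees s. 2 * (1/4) ^ s)"
  proof (rule sum.cong[OF refl])
    fix t assume "t \<in> trees s"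
    thus "prob {\<omega> \<in> space M. T j \<omega> = t} = 2 * (1/4) ^ s"
      using gw_prob_eq[of t] by (simp add: T_law[OF assms] trees_def)
  qed
  also have "\<dots> = real (card (trees s)) * (2 * (1/4) ^ s)" by simp
  also have "\<dots> = 2 * step_weight s"
    by (cases s) (simp_all add: step_weight_def cat_def trees_0 power_one_over)
  finally show ?thesis .
qed

text \<open>Doubled, these are the masses of the size of \<open>T 1\<close>, which sum to 1; this
  replaces an evaluation of the Catalan series at 1/4.\<close>

lemma step_weight_total:
  "step_weight summable_on UNIV" "infsum step_weight UNIV = 1 / 2"
proof -
  obtain q where q: "\<And>s. pmf q s = prob {\<omega> \<in> space M. tsize (T 1 \<omega>) = s}"
    using obtain_law_pmf[OF size_measurable[of 1]] by auto
  hence "pmf q = (\<lambda>s. 2 * step_weight s)"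
    by (auto simp: size_law)
  hence "step_weight = (\<lambda>s. pmf q s * (1 / 2))"
    by auto
  moreover have "(\<lambda>s. pmf q s * (1 / 2)) summable_on UNIV"
    by (intro summable_on_cmult_left pmf_summable_on)
  moreover have "(\<Sum>\<^sub>\<infinity>s. pmf q s * (1 / 2)) = 1 / 2"
    using measure_pmf_infsum[of q UNIV] by (simp add: infsum_cmult_left' del: times_divide_eq_right)
  ultimately show "step_weight summable_on UNIV" "infsum step_weight UNIV = 1 / 2"
    by simp_all
qed

text \<open>Excludes the values at which the truncated \<open>N - 1\<close> and \<open>X - N\<close>
  would misrepresent the pair.\<close>

lemma AE_N_le_X: "AE \<omega> in M. 1 \<le> N \<omega> \<and> N \<omega> \<le> X \<omega>"
proof -
  have "AE \<omega> in M. X \<omega> = k \<and> N \<omega> = m \<longrightarrow> 1 \<le> m \<and> m \<le> k" for k m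
  proof (cases "1 \<le> m \<and> m \<le> k")
    case False
    have [measurable]: "X \<in> M \<rightarrow>\<^sub>M count_space UNIV" "N \<in> M \<rightarrow>\<^sub>M count_space UNIV"
      by (fact X_measurable N_measurable)+
    have "{\<omega> \<in> space M. X \<omega> = k \<and> N \<omega> = m} \<in> events" by measurable
    moreover have "prob {\<omega> \<in> space M. X \<omega> = k \<and> N \<omega> = m} = 0"
      using False by (subst XN_law) auto
    ultimately have "AE \<omega> in M. \<omega> \<notin> {\<omega> \<in> space M. X \<omega> = k \<and> N \<omega> = m}"
      by (simp only: prob_eq_0)
    thus ?thesis by (rule AE_mp) (auto intro!: AE_I2)
  qed simp
  hence "AE \<omega> in M. \<forall>k m. X \<omega> = k \<and> N \<omega> = m \<longrightarrow> 1 \<le> m \<and> m \<le> k"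
    by (simp only: AE_all_countable) simp
  thus ?thesis by eventually_elim auto
qed

section \<open>Joint law of the size lists on the two sides of the tree with index
  \<open>N\<close>\<close>

definition sizes :: "'a \<Rightarrow> nat list \<times> nat list" where
  "sizes \<omega> = (left_sizes (N \<omega>) (\<lambda>j. T j \<omega>), right_sizes (X \<omega>) (N \<omega>) (\<lambda>j. T j \<omega>))"

lemma sizes_measurable: "sizes \<in> M \<rightarrow>\<^sub>M count_space UNIV"
proof -
  have left: "(\<lambda>\<omega>. left_sizes m (\<lambda>j. T j \<omega>)) \<in> M \<rightarrow>\<^sub>M count_space UNIV" for m
    unfolding left_sizes_def by (rule measurable_map_count_space) (rule size_measurable, simp)
  have right: "(\<lambda>\<omega>. right_sizes k m (\<lambda>j. T j \<omega>)) \<in> M \<rightarrow>\<^sub>M count_space UNIV" for k m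
    unfolding right_sizes_def by (rule measurable_map_count_space) (rule size_measurable, auto)
  have "(\<lambda>\<omega>. (l, right_sizes k m (\<lambda>j. T j \<omega>))) \<in> M \<rightarrow>\<^sub>M count_space UNIV" for l k m
    by (rule measurable_compose[OF right]) auto
  hence "(\<lambda>\<omega>. (left_sizes m (\<lambda>j. T j \<omega>), right_sizes k m (\<lambda>j. T j \<omega>))) \<in> M \<rightarrow>\<^sub>M count_space UNIV" for k m
    by (rule measurable_compose_countable) (rule left)
  hence "(\<lambda>\<omega>. (left_sizes (N \<omega>) (\<lambda>j. T j \<omega>), right_sizes k (N \<omega>) (\<lambda>j. T j \<omega>))) \<in> M \<rightarrow>\<^sub>M count_space UNIV" for k
    by (rule measurable_compose_countable) (rule N_measurable)
  hence "(\<lambda>\<omega>. (left_sizes (N \<omega>) (\<lambda>j. T j \<omega>), right_sizes (X \<omega>) (N \<omega>) (\<lambda>j. T j \<omega>))) \<in> M \<rightarrow>\<^sub>M count_space UNIV"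
    by (rule measurable_compose_countable) (rule X_measurable)
  thus ?thesis by (simp add: sizes_def[abs_def])
qed

text \<open>The pair (X, N) has mass 2^(-k-1) at every admissible point with X = k, so N - 1 and X -
  N are independent. With k = l + r + 1, the l + r factors 2 of the size laws leave 1/4.\<close>

lemma sizes_law: "prob {\<omega> \<in> space M. sizes \<omega> = (a, b)} = weight a * weight b / 4"
proof -
  define l where "l = length a"
  define r where "r = length b"
  define k where "k = l + r + 1"
  \<comment> \<open>The index \<open>l + 1\<close>, the value of \<open>N\<close>, is left out: its
    tree enters neither list.\<close>
  define I where "I = {1..l} \<union> {l + 2..k}"
  \<comment> \<open>The list \<open>b\<close> starts at index \<open>k\<close> and runs
    downwards.\<close>
  define \<sigma> where "\<sigma> j = (if j \<le> l then a ! (j - 1) else b ! (k - j))" for j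
  define A :: "nat option \<Rightarrow> (nat \<times> nat + ptree) set" where
    "A i = (case i of None \<Rightarrow> {Inl (k, l + 1)} | Some j \<Rightarrow> Inr ` trees (\<sigma> j))" for i
  define V where "V = (\<lambda>i. case i of None \<Rightarrow> (\<lambda>\<omega>. Inl (X \<omega>, N \<omega>)) | Some j \<Rightarrow> (\<lambda>\<omega>. Inr (T j \<omega>)))"
  define E where "E = (\<Inter>i\<in>insert None (Some ` I). V i -` A i \<inter> space M)"
  have V_None: "V None -` A None \<inter> space M = {\<omega> \<in> space M. X \<omega> = k \<and> N \<omega> = l + 1}"
    by (auto simp: V_def A_def)
  have V_Some: "V (Some j) -` A (Some j) \<inter> space M = {\<omega> \<in> space M. tsize (T j \<omega>) = \<sigma> j}" for j
    by (auto simp: V_def A_def trees_def)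
  have E_iff: "\<omega> \<in> E \<longleftrightarrow> \<omega> \<in> space M \<and> X \<omega> = k \<and> N \<omega> = l + 1 \<and> (\<forall>j\<in>I. tsize (T j \<omega>) = \<sigma> j)" for \<omega>
    by (auto simp: E_def V_def A_def trees_def)
  have sizes_iff: "sizes \<omega> = (a, b) \<longleftrightarrow> \<omega> \<in> E" if \<omega>: "\<omega> \<in> space M" "1 \<le> N \<omega>" "N \<omega> \<le> X \<omega>" for \<omega>
  proof -
    have left: "left_sizes (N \<omega>) (\<lambda>j. T j \<omega>) = a \<longleftrightarrow> N \<omega> = l + 1 \<and> (\<forall>j\<in>{1..l}. tsize (T j \<omega>) = \<sigma> j)"
    proof -
      have "left_sizes (N \<omega>) (\<lambda>j. T j \<omega>) = a \<longleftrightarrow> N \<omega> = l + 1 \<and> (\<forall>i<l. tsize (T (Suc i) \<omega>) = a ! i)"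
        using \<omega> by (auto simp: left_sizes_def list_eq_iff_nth_eq l_def)
      also have "(\<forall>i<l. tsize (T (Suc i) \<omega>) = a ! i) \<longleftrightarrow> (\<forall>j\<in>{1..l}. tsize (T j \<omega>) = \<sigma> j)"
      proof safe
        fix j assume *: "\<forall>i<l. tsize (T (Suc i) \<omega>) = a ! i" and j: "j \<in> {1..l}"
        show "tsize (T j \<omega>) = \<sigma> j"
          using *[rule_format, of "j - 1"] j by (auto simp: \<sigma>_def)
      next
        fix i assume *: "\<forall>j\<in>{1..l}. tsize (T j \<omega>) = \<sigma> j" and i: "i < l"
        show "tsize (T (Suc i) \<omega>) = a ! i"
          using *[rule_format, of "Suc i"] i by (auto simp: \<sigma>_def)
      qed
      finally show ?thesis .
    qed
    \<comment> \<open>The length of the right list determines only \<open>X - N\<close>, so the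
      value of \<open>N\<close> has to come from the left list.\<close>
    have right: "right_sizes (X \<omega>) (N \<omega>) (\<lambda>j. T j \<omega>) = b \<longleftrightarrow>
        X \<omega> = k \<and> (\<forall>j\<in>{l + 2..k}. tsize (T j \<omega>) = \<sigma> j)" if Nl: "N \<omega> = l + 1"
    proof -
      have "right_sizes (X \<omega>) (N \<omega>) (\<lambda>j. T j \<omega>) = b \<longleftrightarrow>
          X \<omega> - N \<omega> = r \<and> (\<forall>i<r. tsize (T (X \<omega> - i) \<omega>) = b ! i)"
        by (auto simp: right_sizes_def list_eq_iff_nth_eq r_def)
      also have "X \<omega> - N \<omega> = r \<longleftrightarrow> X \<omega> = k"
        using \<omega> Nl by (auto simp: k_def)
      also have "X \<omega> = k \<and> (\<forall>i<r. tsize (T (X \<omega> - i) \<omega>) = b ! i) \<longleftrightarrow>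
          X \<omega> = k \<and> (\<forall>i<r. tsize (T (k - i) \<omega>) = b ! i)"
        by auto
      also have "(\<forall>i<r. tsize (T (k - i) \<omega>) = b ! i) \<longleftrightarrow> (\<forall>j\<in>{l + 2..k}. tsize (T j \<omega>) = \<sigma> j)"
      proof safe
        fix j assume *: "\<forall>i<r. tsize (T (k - i) \<omega>) = b ! i" and j: "j \<in> {l + 2..k}"
        show "tsize (T j \<omega>) = \<sigma> j"
          using *[rule_format, of "k - j"] j by (auto simp: \<sigma>_def k_def)
      next
        fix i assume *: "\<forall>j\<in>{l + 2..k}. tsize (T j \<omega>) = \<sigma> j" and i: "i < r"
        show "tsize (T (k - i) \<omega>) = b ! i"
          using *[rule_format, of "k - i"] i by (auto simp: \<sigma>_def k_def)
      qed
      finally show ?thesis .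
    qed
    show ?thesis
      unfolding E_iff sizes_def I_def using left right \<omega> by auto
  qed
  have AE_E: "AE \<omega> in M. \<omega> \<in> {\<omega> \<in> space M. sizes \<omega> = (a, b)} \<longleftrightarrow> \<omega> \<in> E"
    using AE_N_le_X AE_space by eventually_elim (auto simp: sizes_iff)
  have indepV: "indep_vars (\<lambda>_. count_space UNIV) V (insert None (Some ` {1..}))"
    using indep by (simp add: V_def)
  have V_meas: "V i \<in> M \<rightarrow>\<^sub>M count_space UNIV" if "i \<in> insert None (Some ` {1..})" for i
    using indepV that by (auto simp: indep_vars_def)
  have J: "insert None (Some ` I) \<subseteq> insert None (Some ` {1..})"
    by (auto simp: I_def)
  have "E \<in> events"
    unfolding E_def
  proof (rule sets.finite_INT)
    fix i assume "i \<in> insert None (Some ` I)"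
    thus "V i -` A i \<inter> space M \<in> events"
      using J by (intro measurable_sets[OF V_meas]) auto
  qed (auto simp: I_def)
  moreover have "{\<omega> \<in> space M. sizes \<omega> = (a, b)} \<in> events"
    using measurable_sets[OF sizes_measurable, of "{(a, b)}"] by (simp add: vimage_def Int_def conj_commute)
  ultimately have "prob {\<omega> \<in> space M. sizes \<omega> = (a, b)} = prob E"
    by (intro finite_measure_eq_AE AE_E)
  also have "\<dots> = (\<Prod>i\<in>insert None (Some ` I). prob (V i -` A i \<inter> space M))"
    unfolding E_def
    by (rule indep_varsD[OF indepV]) (use J in \<open>auto simp: I_def\<close>)
  also have "\<dots> = prob (V None -` A None \<inter> space M) * (\<Prod>j\<in>I. prob (V (Some j) -` A (Some j) \<inter> space M))"
    by (subst prod.insert) (auto simp: I_def prod.reindex)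
  also have "\<dots> = (1/2) ^ (k + 1) * (\<Prod>j\<in>I. 2 * step_weight (\<sigma> j))"
  proof (intro arg_cong2[where f = "(*)"] prod.cong refl)
    have "1 \<le> k" "l + 1 \<le> k" by (simp_all add: k_def)
    thus "prob (V None -` A None \<inter> space M) = (1/2) ^ (k + 1)"
      unfolding V_None XN_law by simp
    fix j assume "j \<in> I"
    thus "prob (V (Some j) -` A (Some j) \<inter> space M) = 2 * step_weight (\<sigma> j)"
      unfolding V_Some by (intro size_law) (auto simp: I_def)
  qed
  also have "(\<Prod>j\<in>I. 2 * step_weight (\<sigma> j))
      = (\<Prod>j\<in>{1..l}. 2 * step_weight (\<sigma> j)) * (\<Prod>j\<in>{l + 2..k}. 2 * step_weight (\<sigma> j))"
    unfolding I_def by (rule prod.union_disjoint) auto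
  also have "(\<Prod>j\<in>{1..l}. 2 * step_weight (\<sigma> j)) = (\<Prod>i<l. 2 * step_weight (a ! i))"
    by (rule prod.reindex_bij_witness[of _ Suc "\<lambda>j. j - 1"]) (auto simp: \<sigma>_def)
  also have "(\<Prod>j\<in>{l + 2..k}. 2 * step_weight (\<sigma> j)) = (\<Prod>i<r. 2 * step_weight (b ! i))"
    by (rule prod.reindex_bij_witness[of _ "\<lambda>i. k - i" "\<lambda>j. k - j"]) (auto simp: \<sigma>_def k_def)
  also have "(\<Prod>i<l. 2 * step_weight (a ! i)) = 2 ^ l * weight a"
    by (simp add: prod.distrib weight_def l_def prod.list_conv_set_nth atLeast0LessThan)
  also have "(\<Prod>i<r. 2 * step_weight (b ! i)) = 2 ^ r * weight b"
    by (simp add: prod.distrib weight_def r_def prod.list_conv_set_nth atLeast0LessThan)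
  also have "(1/2) ^ (k + 1) * (2 ^ l * weight a * (2 ^ r * weight b)) = weight a * weight b / 4"
    by (simp add: k_def power_add power_one_over)
  finally show ?thesis .
qed

lemma obtain_config_law:
  obtains q :: "(nat set \<times> nat set) pmf"
  where "\<And>f :: _ \<Rightarrow> real. measure_pmf.expectation q f =
           (\<integral>\<omega>. f (ones_pos (fst (sizes \<omega>)), ones_pos (snd (sizes \<omega>))) \<partial>M)"
    and "\<And>x. x \<in> set_pmf q \<Longrightarrow> \<exists>g h. x = (gapset g, gapset h)"
    and "\<And>g h. pmf q (gapset g, gapset h)
           = 4 / 9 * real (gapprod g * gapprod h) * (1 / 4) ^ (gaplen g + gaplen h)"
proof -
  obtain q where q: "measure_pmf q = distr M (count_space UNIV) sizes"
    "\<And>x. pmf q x = prob {\<omega> \<in> space M. sizes \<omega> = x}"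
    using obtain_law_pmf[OF sizes_measurable] by blast
  define c where "c = (\<lambda>(a, b). (ones_pos a, ones_pos b))"
  have pmf_q: "pmf q (a, b) = weight a * weight b / 4" for a b
    unfolding q(2) by (rule sizes_law)
  \<comment> \<open>With the second list fixed as empty, the joint law is \<open>weight\<close> up
    to the factor 1/4, which proves \<open>weight\<close> summable.\<close>
  have "(\<lambda>x. pmf q x * 4) summable_on (\<lambda>a. (a, [])) ` UNIV"
    by (intro summable_on_cmult_left pmf_summable_on)
  hence "(\<lambda>x. pmf q x * 4) \<circ> (\<lambda>a. (a, [])) summable_on UNIV"
    by (subst (asm) summable_on_reindex) (auto simp: inj_on_def)
  hence summable: "weight summable_on UNIV"
    by (simp add: o_def pmf_q)
  note infsum_gapset = infsum_weight_gapset[OF summable step_weight_total]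
  show thesis
  proof (rule that[of "map_pmf c q"])
    fix f :: "nat set \<times> nat set \<Rightarrow> real"
    have "measure_pmf.expectation (map_pmf c q) f = measure_pmf.expectation q (\<lambda>x. f (c x))"
      by simp
    also have "\<dots> = (\<integral>\<omega>. f (c (sizes \<omega>)) \<partial>M)"
      unfolding q(1) by (rule integral_distr[OF sizes_measurable]) simp
    finally show "measure_pmf.expectation (map_pmf c q) f =
           (\<integral>\<omega>. f (ones_pos (fst (sizes \<omega>)), ones_pos (snd (sizes \<omega>))) \<partial>M)"
      by (simp add: c_def case_prod_beta)
  next
    fix x assume "x \<in> set_pmf (map_pmf c q)"
    then obtain a b where "x = (ones_pos a, ones_pos b)"
      by (auto simp: c_def)
    thus "\<exists>g h. x = (gapset g, gapset h)"
      using ones_pos_eq_gapset by metis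
  next
    fix g h
    define Eg where "Eg = {a. ones_pos a = gapset g}"
    define Eh where "Eh = {a. ones_pos a = gapset h}"
    have "pmf (map_pmf c q) (gapset g, gapset h) = measure (measure_pmf q) (Eg \<times> Eh)"
      unfolding pmf_map by (rule arg_cong[where f = "measure (measure_pmf q)"]) (auto simp: c_def Eg_def Eh_def)
    also have "\<dots> = infsum (pmf q) (Eg \<times> Eh)"
      by (rule measure_pmf_infsum)
    also have "\<dots> = (\<Sum>\<^sub>\<infinity>a\<in>Eg. \<Sum>\<^sub>\<infinity>b\<in>Eh. pmf q (a, b))"
      by (rule infsum_Sigma_banach[symmetric]) (rule pmf_summable_on)
    also have "\<dots> = (\<Sum>\<^sub>\<infinity>a\<in>Eg. \<Sum>\<^sub>\<infinity>b\<in>Eh. weight a * (weight b * (1/4)))"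
      by (simp add: pmf_q)
    also have "\<dots> = infsum weight Eg * (infsum weight Eh * (1/4))"
      by (simp only: infsum_cmult_left' infsum_cmult_right')
    \<comment> \<open>The constant is 4/3 for each end times the stopping factor 1/4.\<close>
    also have "\<dots> = 4 / 9 * real (gapprod g * gapprod h) * (1 / 4) ^ (gaplen g + gaplen h)"
      unfolding Eg_def Eh_def infsum_gapset by (simp add: power_add power_one_over)
    finally show "pmf (map_pmf c q) (gapset g, gapset h)
           = 4 / 9 * real (gapprod g * gapprod h) * (1 / 4) ^ (gaplen g + gaplen h)" .
  qed
qed

end

text \<open>Once \<open>n\<close> is at least twice the total gap length, the probability equals a
  constant times F_(n - len) / C_n exactly, so only this ratio has a limit to take.\<close>

lemma pmf_left_right_fix_tendsto:
  "(\<lambda>n. pmf (map_pmf (\<lambda>\<tau>. (left_fix n \<tau>, right_fix n \<tau>)) (pmf_of_set (Av321 n))) (gapset g, gapset h))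
     \<longlonglongrightarrow> 4 / 9 * real (gapprod g * gapprod h) * (1 / 4) ^ (gaplen g + gaplen h)"
proof -
  let ?p = "\<lambda>n. map_pmf (\<lambda>\<tau>. (left_fix n \<tau>, right_fix n \<tau>)) (pmf_of_set (Av321 n))"
  define len where "len = gaplen g + gaplen h"
  have eq: "pmf (?p n) (gapset g, gapset h)
      = real (gapprod g * gapprod h) * (real (fine_num (n - len)) / real (cat n))" if n: "2 * len \<le> n" for n
  proof -
    have "pmf (?p n) (gapset g, gapset h) = real (card (Av321 n \<inter> {\<tau>. left_fix n \<tau> = gapset g \<and> right_fix n \<tau> = gapset h}))
        / real (card (Av321 n))"
      unfolding pmf_map
      by (subst measure_pmf_of_set) (use id_in_Av321[of n] in \<open>auto simp: finite_Av321 vimage_def\<close>)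
    also have "Av321 n \<inter> {\<tau>. left_fix n \<tau> = gapset g \<and> right_fix n \<tau> = gapset h}
        = {\<tau> \<in> Av321 n. left_fix n \<tau> = gapset g \<and> right_fix n \<tau> = gapset h}"
      by auto
    finally show ?thesis
      using card_left_right_fix[of g h n] n by (simp add: card_Av321 len_def)
  qed
  have "\<forall>\<^sub>F n in sequentially. real (gapprod g * gapprod h) * (real (fine_num (n - len)) / real (cat n))
      = pmf (?p n) (gapset g, gapset h)"
    by (rule eventually_sequentiallyI[of "2 * len"]) (rule eq[symmetric])
  moreover have "(\<lambda>n. real (gapprod g * gapprod h) * (real (fine_num (n - len)) / real (cat n)))
      \<longlonglongrightarrow> real (gapprod g * gapprod h) * (4 / 9 * (1 / 4) ^ len)"
    by (intro tendsto_mult tendsto_const fine_cat_ratio_diff)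
  ultimately have "(\<lambda>n. pmf (?p n) (gapset g, gapset h)) \<longlonglongrightarrow> real (gapprod g * gapprod h) * (4 / 9 * (1 / 4) ^ len)"
    by (rule Lim_transform_eventually[rotated])
  thus ?thesis by (simp add: len_def mult_ac)
qed

theorem theorem4p1:
  fixes M :: "'a measure" and T :: "nat \<Rightarrow> 'a \<Rightarrow> ptree" and X N :: "'a \<Rightarrow> nat"
  assumes "prob_space M"
    and "\<And>j. j \<ge> 1 \<Longrightarrow> T j \<in> M \<rightarrow>\<^sub>M count_space UNIV"
    and "X \<in> M \<rightarrow>\<^sub>M count_space UNIV"
    and "N \<in> M \<rightarrow>\<^sub>M count_space UNIV"
    and "prob_space.indep_vars M (\<lambda>_. count_space UNIV)
           (\<lambda>i. case i of None \<Rightarrow> (\<lambda>\<omega>. Inl (X \<omega>, N \<omega>)) | Some j \<Rightarrow> (\<lambda>\<omega>. Inr (T j \<omega>)))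
           (insert None (Some ` {1..}))"
    and "\<And>j t. j \<ge> 1 \<Longrightarrow> measure M {\<omega> \<in> space M. T j \<omega> = t} = gw_prob t"
    and "\<And>k m. measure M {\<omega> \<in> space M. X \<omega> = k \<and> N \<omega> = m} =
           (if 1 \<le> k \<and> 1 \<le> m \<and> m \<le> k then (real k * (1/2) ^ (k + 1)) * (1 / real k) else 0)"
  shows "\<forall>F. continuous_map (prod_topology MF_topology MF_topology) euclideanreal F \<and>
             (\<exists>B. \<forall>x \<in> topspace (prod_topology MF_topology MF_topology). \<bar>F x\<bar> \<le> B) \<longrightarrow>
           (\<lambda>n. measure_pmf.expectation (pmf_of_set (Av321 n)) (\<lambda>\<tau>. F (fixed_measures n \<tau>)))
             \<longlonglongrightarrow> (\<integral>\<omega>. F (limit_measures (X \<omega>) (N \<omega>) (\<lambda>j. T j \<omega>)) \<partial>M)"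
proof (intro allI impI, elim conjE exE)
  fix F :: "(nat \<Rightarrow> real) \<times> (nat \<Rightarrow> real) \<Rightarrow> real" and B
  assume B: "\<forall>x \<in> topspace (prod_topology MF_topology MF_topology). \<bar>F x\<bar> \<le> B"
  interpret prob_space M by fact
  interpret gw_forest M T X N by unfold_locales (fact assms)+
  obtain q where q: "\<And>f :: _ \<Rightarrow> real. measure_pmf.expectation q f =
           (\<integral>\<omega>. f (ones_pos (fst (sizes \<omega>)), ones_pos (snd (sizes \<omega>))) \<partial>M)"
    "\<And>x. x \<in> set_pmf q \<Longrightarrow> \<exists>g h. x = (gapset g, gapset h)"
    "\<And>g h. pmf q (gapset g, gapset h)
           = 4 / 9 * real (gapprod g * gapprod h) * (1 / 4) ^ (gaplen g + gaplen h)"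
    using obtain_config_law by blast
  define p where "p n = map_pmf (\<lambda>\<tau>. (left_fix n \<tau>, right_fix n \<tau>)) (pmf_of_set (Av321 n))" for n
  define ok where "ok = (\<lambda>A :: nat set. finite A \<and> 0 \<notin> A)"
  \<comment> \<open>\<open>F\<close> is bounded on the topological space only, so it is replaced by
    0 at sets whose indicators are not finite measures on the positive integers; neither law charges
    such sets.\<close>
  define f where "f = (\<lambda>(A, A'). if ok A \<and> ok A' then F (indicator A, indicator A') else 0)"
  have "\<bar>f x\<bar> \<le> \<bar>B\<bar>" for x
  proof (cases x)
    case (Pair A A')
    show ?thesis
    proof (cases "ok A \<and> ok A'")
      case True
      hence "(indicator A, indicator A') \<in> topspace (prod_topology MF_topology MF_topology)"
        by (auto simp: ok_def intro!: indicator_in_MF[THEN subsetD[OF MF_subset_topspace]])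
      hence "\<bar>F (indicator A, indicator A')\<bar> \<le> \<bar>B\<bar>" using B by fastforce
      thus ?thesis by (simp add: f_def Pair)
    next
      case False
      thus ?thesis by (auto simp: f_def Pair)
    qed
  qed
  \<comment> \<open>Convergence of masses is required only on the support of \<open>q\<close>, which
    consists of pairs of gap sets.\<close>
  moreover have "(\<lambda>n. pmf (p n) x) \<longlonglongrightarrow> pmf q x" if x: "x \<in> set_pmf q" for x
  proof -
    obtain g h where "x = (gapset g, gapset h)" using q(2)[OF x] by blast
    thus ?thesis
      using pmf_left_right_fix_tendsto[of g h] by (simp only: p_def q(3))
  qed
  ultimately have "(\<lambda>n. measure_pmf.expectation (p n) f) \<longlonglongrightarrow> measure_pmf.expectation q f"
    by (intro expectation_tendsto_pmf[where B = "\<bar>B\<bar>"])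
  moreover have "measure_pmf.expectation (p n) f
      = measure_pmf.expectation (pmf_of_set (Av321 n)) (\<lambda>\<tau>. F (fixed_measures n \<tau>))" for n
  proof -
    have "ok (left_fix n \<tau>)" "ok (right_fix n \<tau>)" for \<tau>
      by (auto simp: ok_def left_fix_def right_fix_def fixset_def)
    thus ?thesis by (simp add: p_def f_def fixed_measures_eq)
  qed
  moreover have "measure_pmf.expectation q f = (\<integral>\<omega>. F (limit_measures (X \<omega>) (N \<omega>) (\<lambda>j. T j \<omega>)) \<partial>M)"
  proof -
    have "finite (ones_pos a)" for a
      by (induction a) auto
    hence "ok (ones_pos a)" for a
      by (simp add: ok_def zero_notin_ones_pos)
    thus ?thesis by (simp add: q(1) f_def limit_measures_eq sizes_def)
  qed
  ultimately show "(\<lambda>n. measure_pmf.expectation (pmf_of_set (Av321 n)) (\<lambda>\<tau>. F (fixed_measures n \<tau>)))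
             \<longlonglongrightarrow> (\<integral>\<omega>. F (limit_measures (X \<omega>) (N \<omega>) (\<lambda>j. T j \<omega>)) \<partial>M)"
    by simp
qed

end
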